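(* Let $X$ be a proper and almost extendible CAT(0) space, let $\gamma$ be a hyperbolic isometry of $X$, and let $r$ be a reflection of $X$ with fixed-point set $F_r$. Suppose that (1) $\gamma^{\infty}\notin\partial F_r$, (2) $\gamma(\partial F_r)\subset\partial F_r$, and (3) $\operatorname{Min}(\gamma)\cap F_r=\emptyset$. Then the boundary $\partial X$ of $X$ is not locally connected.
   Context: A metric space is proper if every closed metric ball is compact. For a proper CAT(0) space $X$, $\partial X$ denotes its visual boundary (asymptotic classes of geodesic rays) with the cone topology; for a subset $A\subset X$, $\partial A\subset\partial X$ denotes the set of boundary points represented by geodesic rays contained in $A$. A CAT(0) space $X$ is almost extendible if there is a constant $M>0$ such that for every pair of points $x,y\in X$ there is a geodesic ray $\zeta:[0,\infty)\to X$ with $\zeta(0)=x$ that passes within distance $M$ of $y$. For an isometry $\gamma$ of $X$, its translation length is $|\gamma|=\inf\{d(x,\gamma x)\mid x\in X\}$ and $\operatorname{Min}(\gamma)=\{x\in X\mid d(x,\gamma x)=|\gamma|\}$; $\gamma$ is hyperbolic if $\operatorname{Min}(\gamma)\neq\emptyset$ and $|\gamma|>0$. For a hyperbolic isometry $\gamma$, $\gamma^\infty\in\partial X$ is the limit point of the sequence $\{\gamma^i x_0\}_i$ for $x_0\in X$. A reflection of a geodesic space $X$ is an isometry $r$ of $X$ such that (i) $r^2$ is the identity, (ii) $X\setminus F_r$ has exactly two connected components $X_r^+$ and $X_r^-$, each convex, where $F_r$ is the fixed-point set of $r$, and (iii) $rX_r^+=X_r^-$ (it is not required that $F_r$ have empty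 interior). *)

theory Defs
  imports "HOL-Analysis.Analysis"
begin

text \<open>The CAT(0) space X is the whole type 'a (a metric space).\<close>

definition geodesic_seg :: "(real \<Rightarrow> 'a::metric_space) \<Rightarrow> 'a \<Rightarrow> 'a \<Rightarrow> bool" where
  "geodesic_seg c x y \<longleftrightarrow> c 0 = x \<and> c (dist x y) = y \<and>
     (\<forall>s\<in>{0..dist x y}. \<forall>t\<in>{0..dist x y}. dist (c s) (c t) = \<bar>s - t\<bar>)"

definition geodesic_space :: "'a::metric_space itself \<Rightarrow> bool" where
  "geodesic_space TYPE('a) \<longleftrightarrow> (\<forall>x y::'a. \<exists>c. geodesic_seg c x y)"

text \<open>Comparison point in the Euclidean plane (complex numbers) on the side from P to Q
  at distance s from P.\<close>
definition cmp_pt :: "complex \<Rightarrow> complex \<Rightarrow> real \<Rightarrow> complex" where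
  "cmp_pt P Q s = P + of_real (s / dist P Q) * (Q - P)"

definition tri_pairs ::
  "(real \<Rightarrow> 'a::metric_space) \<Rightarrow> (real \<Rightarrow> 'a) \<Rightarrow> (real \<Rightarrow> 'a) \<Rightarrow> 'a \<Rightarrow> 'a \<Rightarrow> 'a
    \<Rightarrow> complex \<Rightarrow> complex \<Rightarrow> complex \<Rightarrow> ('a \<times> complex) set" where
  "tri_pairs c1 c2 c3 p q r P Q R =
     {(c1 s, cmp_pt P Q s) | s. s \<in> {0..dist p q}} \<union>
     {(c2 s, cmp_pt Q R s) | s. s \<in> {0..dist q r}} \<union>
     {(c3 s, cmp_pt R P s) | s. s \<in> {0..dist r p}}"

definition CAT0 :: "'a::metric_space itself \<Rightarrow> bool" where
  "CAT0 TYPE('a) \<longleftrightarrow> geodesic_space TYPE('a) \<and>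
     (\<forall>(p::'a) q r c1 c2 c3 (P::complex) Q R.
        geodesic_seg c1 p q \<and> geodesic_seg c2 q r \<and> geodesic_seg c3 r p \<and>
        dist P Q = dist p q \<and> dist Q R = dist q r \<and> dist R P = dist r p \<longrightarrow>
        (\<forall>(x, x')\<in>tri_pairs c1 c2 c3 p q r P Q R. \<forall>(y, y')\<in>tri_pairs c1 c2 c3 p q r P Q R.
            dist x y \<le> dist x' y'))"

definition proper_space :: "'a::metric_space itself \<Rightarrow> bool" where
  "proper_space TYPE('a) \<longleftrightarrow> (\<forall>(x::'a) e. compact (cball x e))"

definition geodesic_ray :: "(real \<Rightarrow> 'a::metric_space) \<Rightarrow> bool" where
  "geodesic_ray c \<longleftrightarrow> (\<forall>s\<ge>0. \<forall>t\<ge>0. dist (c s) (c t) = \<bar>s - t\<bar>)"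

definition asymptotic :: "(real \<Rightarrow> 'a::metric_space) \<Rightarrow> (real \<Rightarrow> 'a) \<Rightarrow> bool" where
  "asymptotic c c' \<longleftrightarrow> (\<exists>C. \<forall>t\<ge>0. dist (c t) (c' t) \<le> C)"

definition ray_class :: "(real \<Rightarrow> 'a::metric_space) \<Rightarrow> (real \<Rightarrow> 'a) set" where
  "ray_class c = {c'. geodesic_ray c' \<and> asymptotic c c'}"

definition vis_bdry :: "(real \<Rightarrow> 'a::metric_space) set set" where
  "vis_bdry = {ray_class c | c. geodesic_ray c}"

definition bdry_of :: "'a::metric_space set \<Rightarrow> (real \<Rightarrow> 'a) set set" where
  "bdry_of A = {\<xi> \<in> vis_bdry. \<exists>c\<in>\<xi>. c ` {0..} \<subseteq> A}"

definition cone_nbhd :: "'a::metric_space \<Rightarrow> (real \<Rightarrow> 'a) \<Rightarrow> real \<Rightarrow> real \<Rightarrow> (real \<Rightarrow> 'a) set set" where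
  "cone_nbhd x0 c t e = {\<xi> \<in> vis_bdry. \<exists>c'\<in>\<xi>. c' 0 = x0 \<and> dist (c' t) (c t) < e}"

definition cone_topology :: "'a::metric_space \<Rightarrow> (real \<Rightarrow> 'a) set topology" where
  "cone_topology x0 = topology_generated_by
     {cone_nbhd x0 c t e | c t e. geodesic_ray c \<and> c 0 = x0 \<and> t > 0 \<and> e > 0}"

text \<open>Convergence of a sequence of points of X to a boundary point in the cone topology
  of X \<union> \<partial>X (base point x0).\<close>
definition conv_to_bdry :: "'a::metric_space \<Rightarrow> (nat \<Rightarrow> 'a) \<Rightarrow> (real \<Rightarrow> 'a) set \<Rightarrow> bool" where
  "conv_to_bdry x0 xs \<xi> \<longleftrightarrow> \<xi> \<in> vis_bdry \<and>
     (\<forall>c\<in>\<xi>. c 0 = x0 \<longrightarrow> (\<forall>t>0. \<forall>e>0. eventually (\<lambda>i. dist x0 (xs i) > t \<and>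
         (\<exists>\<sigma>. geodesic_seg \<sigma> x0 (xs i) \<and> dist (\<sigma> t) (c t) < e)) sequentially))"

definition almost_extendible :: "'a::metric_space itself \<Rightarrow> bool" where
  "almost_extendible TYPE('a) \<longleftrightarrow> (\<exists>M>0. \<forall>x y::'a. \<exists>\<zeta>. geodesic_ray \<zeta> \<and> \<zeta> 0 = x \<and>
       (\<exists>t\<ge>0. dist (\<zeta> t) y \<le> M))"

definition isometry :: "('a::metric_space \<Rightarrow> 'a) \<Rightarrow> bool" where
  "isometry g \<longleftrightarrow> surj g \<and> (\<forall>x y. dist (g x) (g y) = dist x y)"

definition transl_len :: "('a::metric_space \<Rightarrow> 'a) \<Rightarrow> real" where
  "transl_len g = Inf {dist x (g x) | x. True}"

definition Min_set :: "('a::metric_space \<Rightarrow> 'a) \<Rightarrow> 'a set" where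
  "Min_set g = {x. dist x (g x) = transl_len g}"

definition hyperbolic :: "('a::metric_space \<Rightarrow> 'a) \<Rightarrow> bool" where
  "hyperbolic g \<longleftrightarrow> isometry g \<and> Min_set g \<noteq> {} \<and> transl_len g > 0"

definition bdry_act :: "('a::metric_space \<Rightarrow> 'a) \<Rightarrow> (real \<Rightarrow> 'a) set \<Rightarrow> (real \<Rightarrow> 'a) set" where
  "bdry_act g \<xi> = ray_class (g \<circ> (SOME c. c \<in> \<xi>))"

definition geo_convex :: "'a::metric_space set \<Rightarrow> bool" where
  "geo_convex A \<longleftrightarrow> (\<forall>x\<in>A. \<forall>y\<in>A. \<forall>c. geodesic_seg c x y \<longrightarrow> c ` {0..dist x y} \<subseteq> A)"

definition reflection :: "('a::metric_space \<Rightarrow> 'a) \<Rightarrow> bool" where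
  "reflection r \<longleftrightarrow> isometry r \<and> r \<circ> r = id \<and>
     (\<exists>A B. A \<noteq> B \<and> components (- {x. r x = x}) = {A, B} \<and>
        geo_convex A \<and> geo_convex B \<and> r ` A = B)"

end

theory Submission
  imports Defs
begin

text \<open>Let \<open>F\<close> be the fixed-point set of \<open>r\<close>. The displacement \<open>x \<mapsto> d(x, r x)\<close> is convex and vanishes
  exactly on \<open>F\<close>, and along a ray it is bounded if and only if the ray ends in \<open>\<partial>F\<close>. Hence
  \<open>\<partial>X - \<partial>F\<close> is the disjoint union of two open sets, the end points of rays that go off into one or the
  other component of \<open>X - F\<close>. The same holds for the conjugates \<open>r\<^sub>n = \<gamma>\<^sup>n r \<gamma>\<^sup>-\<^sup>n\<close>, whose fixed-point sets
  have boundary \<open>\<gamma>\<^sup>n \<partial>F \<subseteq> \<partial>F\<close>. The convex set \<open>Min(\<gamma>)\<close> lies in a single component of each \<open>X - \<gamma>\<^sup>n F\<close>, and so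
  does an axis of \<open>\<gamma>\<close>. Choose \<open>x\<close> far from \<open>F\<close> in the other component of \<open>X - F\<close>. A ray from the axis passing
  close to \<open>\<gamma>\<^sup>n x\<close> has to cross \<open>\<gamma>\<^sup>n F\<close> and ends on the far side of it. These end points converge to
  \<open>\<gamma>\<^sup>\<infinity>\<close>, so a connected neighbourhood of \<open>\<gamma>\<^sup>\<infinity>\<close> missing \<open>\<partial>F\<close> would be split by some \<open>\<gamma>\<^sup>n \<partial>F\<close>.\<close>

section \<open>Comparison triangles and geodesics\<close>

lemma comparison_triangle_exists:
  fixes a b c :: real
  assumes "0 \<le> a" "0 \<le> b" "0 \<le> c" "a \<le> b + c" "b \<le> a + c" "c \<le> a + b"
  shows "\<exists>P Q R::complex. dist P Q = a \<and> dist Q R = b \<and> dist R P = c"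
proof (cases "a = 0")
  case True
  then have "b = c" using assms by simp
  then have "dist (0::complex) 0 = a \<and> dist 0 (of_real c :: complex) = b \<and> dist (of_real c :: complex) 0 = c"
    using True assms by (simp add: dist_norm)
  then show ?thesis by blast
next
  case False
  then have a: "a > 0" using assms by simp
  \<comment> \<open>With \<open>P = 0\<close> and \<open>Q = a\<close> on the real axis, the law of
    cosines makes \<open>x\<close> the real part of the apex \<open>R\<close>.\<close>
  define x where "x = (a\<^sup>2 + c\<^sup>2 - b\<^sup>2) / (2 * a)"
  have 2: "2 * a * x = a\<^sup>2 + c\<^sup>2 - b\<^sup>2" using a by (simp add: x_def)
  have "\<bar>x\<bar> \<le> c"
  proof -
    have "(a - c)\<^sup>2 \<le> b\<^sup>2" using assms by (intro abs_le_square_iff[THEN iffD1]) auto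
    then have "2 * a * x \<le> 2 * a * c" using 2 by (simp add: power2_eq_square algebra_simps)
    moreover have "b\<^sup>2 \<le> (a + c)\<^sup>2" using assms by (intro power_mono) auto
    then have "2 * a * x \<ge> 2 * a * (- c)" using 2 by (simp add: power2_eq_square algebra_simps)
    ultimately have "x \<le> c" "- c \<le> x"
      using a by (simp_all only: mult_le_cancel_left_pos[of "2 * a"] mult_pos_pos zero_less_numeral)
    then show ?thesis by simp
  qed
  then have x2: "x\<^sup>2 \<le> c\<^sup>2" using assms(3) by (simp add: abs_le_square_iff[symmetric])
  define R where "R = Complex x (sqrt (c\<^sup>2 - x\<^sup>2))"
  have "dist R 0 = c"
    using x2 assms(3) by (simp add: R_def dist_norm complex_norm)
  moreover have "(a - x)\<^sup>2 + (c\<^sup>2 - x\<^sup>2) = b\<^sup>2"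
    using 2 by (simp add: power2_eq_square algebra_simps)
  then have "dist (of_real a) R = b"
    using x2 assms(2) by (simp add: R_def dist_norm cmod_def)
  moreover have "dist (0::complex) (of_real a) = a" using a by simp
  ultimately show ?thesis by blast
qed

lemma geodesic_seg_reverse:
  assumes "geodesic_seg c x y"
  shows "geodesic_seg (\<lambda>t. c (dist x y - t)) y x"
  using assms unfolding geodesic_seg_def by (auto simp: dist_commute)

lemma geodesic_seg_dist_start:
  assumes "geodesic_seg c x y" "0 \<le> t" "t \<le> dist x y"
  shows "dist x (c t) = t"
  using assms unfolding geodesic_seg_def by force

lemma geodesic_seg_continuous_on:
  assumes "geodesic_seg c x y"
  shows "continuous_on {0..dist x y} c"
  using assms unfolding geodesic_seg_def continuous_on_iff
  by (metis dist_real_def)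

lemma geodesic_ray_continuous_on:
  assumes "geodesic_ray c"
  shows "continuous_on {0..} c"
  using assms unfolding geodesic_ray_def continuous_on_iff
  by (metis atLeast_iff dist_real_def)

lemma geodesic_ray_segment:
  assumes "geodesic_ray c" "0 \<le> a" "a \<le> b"
  shows "geodesic_seg (\<lambda>u. c (a + u)) (c a) (c b)"
  using assms unfolding geodesic_seg_def geodesic_ray_def by auto

lemma geodesic_ray_initial_segment:
  assumes "geodesic_ray c" "0 \<le> b"
  shows "geodesic_seg c (c 0) (c b)"
  using geodesic_ray_segment[OF assms(1) order_refl assms(2)] by simp

lemma geodesic_seg_isometry:
  assumes "isometry g" "geodesic_seg c x y"
  shows "geodesic_seg (g \<circ> c) (g x) (g y)"
  using assms unfolding geodesic_seg_def isometry_def by auto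

lemma geodesic_ray_isometry:
  assumes "isometry g" "geodesic_ray c"
  shows "geodesic_ray (g \<circ> c)"
  using assms unfolding geodesic_ray_def isometry_def by auto

lemma cmp_pt_scaled: "cmp_pt P Q (s * dist P Q) = P + of_real s * (Q - P)"
  by (simp add: cmp_pt_def)

text \<open>Points at the same ratio on two sides issuing from \<open>p\<close> have comparison
  points that differ by \<open>s * (Q - R)\<close>. The third side of a comparison triangle runs
  from \<open>r\<close> to \<open>p\<close>, so \<open>\<tau>\<close> is reversed and read at ratio
  \<open>1 - s\<close>.\<close>

lemma CAT0_dist_scaled:
  fixes p q r :: "'a::metric_space"
  assumes cat: "CAT0 TYPE('a)"
    and \<sigma>: "geodesic_seg \<sigma> p q" and \<tau>: "geodesic_seg \<tau> p r" and s: "0 \<le> s" "s \<le> 1"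
  shows "dist (\<sigma> (s * dist p q)) (\<tau> (s * dist p r)) \<le> s * dist q r"
proof -
  obtain c2 where c2: "geodesic_seg c2 q r"
    using cat unfolding CAT0_def geodesic_space_def by blast
  let ?c3 = "\<lambda>t. \<tau> (dist p r - t)"
  have c3: "geodesic_seg ?c3 r p" by (rule geodesic_seg_reverse[OF \<tau>])
  obtain P Q R :: complex where PQR: "dist P Q = dist p q" "dist Q R = dist q r" "dist R P = dist r p"
    using comparison_triangle_exists[of "dist p q" "dist q r" "dist r p"]
    by (metis dist_commute dist_triangle zero_le_dist)
  have "\<forall>(x, x')\<in>tri_pairs \<sigma> c2 ?c3 p q r P Q R. \<forall>(y, y')\<in>tri_pairs \<sigma> c2 ?c3 p q r P Q R.
            dist x y \<le> dist x' y'"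
    using cat \<sigma> c2 c3 PQR unfolding CAT0_def by blast
  moreover have "(\<sigma> (s * dist p q), cmp_pt P Q (s * dist p q)) \<in> tri_pairs \<sigma> c2 ?c3 p q r P Q R"
    using s by (auto simp: tri_pairs_def mult_left_le_one_le)
  moreover have "(?c3 ((1 - s) * dist r p), cmp_pt R P ((1 - s) * dist r p)) \<in> tri_pairs \<sigma> c2 ?c3 p q r P Q R"
    using s by (auto simp: tri_pairs_def mult_left_le_one_le)
  ultimately have "dist (\<sigma> (s * dist p q)) (?c3 ((1 - s) * dist r p))
      \<le> dist (cmp_pt P Q (s * dist p q)) (cmp_pt R P ((1 - s) * dist r p))"
    by blast
  moreover have "dist p r - (1 - s) * dist r p = s * dist p r"
    by (simp add: dist_commute algebra_simps)
  moreover have "cmp_pt P Q (s * dist p q) - cmp_pt R P ((1 - s) * dist r p) = of_real s * (Q - R)"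
    unfolding PQR(1)[symmetric] PQR(3)[symmetric] cmp_pt_scaled by (simp add: algebra_simps)
  then have "dist (cmp_pt P Q (s * dist p q)) (cmp_pt R P ((1 - s) * dist r p)) = s * dist q r"
    using s PQR(2) by (simp add: dist_norm norm_mult)
  ultimately show ?thesis by simp
qed

section \<open>Isometries and their displacement\<close>

lemma isometry_dist: "isometry g \<Longrightarrow> dist (g x) (g y) = dist x y"
  by (simp add: isometry_def)

lemma isometry_inj: "isometry g \<Longrightarrow> inj g"
  unfolding isometry_def by (metis dist_eq_0_iff injI)

lemma isometry_inv_f: "isometry g \<Longrightarrow> inv g (g x) = x"
  by (simp add: isometry_inj)

lemma isometry_f_inv: "isometry g \<Longrightarrow> g (inv g x) = x"
  by (simp add: isometry_def surj_f_inv_f)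

lemma isometry_inv: "isometry g \<Longrightarrow> isometry (inv g)"
  using isometry_f_inv[of g] isometry_inj[of g] unfolding isometry_def
  by (metis inj_imp_surj_inv)

lemma isometry_comp: "isometry g \<Longrightarrow> isometry h \<Longrightarrow> isometry (g \<circ> h)"
  unfolding isometry_def by (metis comp_apply comp_surj)

lemma isometry_funpow: "isometry g \<Longrightarrow> isometry (g ^^ n)"
  by (induction n) (auto intro: isometry_comp simp: isometry_def[of id])

lemma isometry_continuous_on: "isometry g \<Longrightarrow> continuous_on S g"
  unfolding isometry_def continuous_on_iff by metis

lemma closed_fixpoints_isometry: "isometry g \<Longrightarrow> closed {x. g x = x}"
  by (intro closed_Collect_eq isometry_continuous_on continuous_intros)

lemma displacement_le:
  assumes "isometry g"
  shows "dist x (g x) \<le> dist y (g y) + 2 * dist x y"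
proof -
  have "dist x (g x) \<le> dist x y + dist y (g y) + dist (g y) (g x)"
    by (meson add_right_mono dist_triangle dist_triangle_le order_trans)
  then show ?thesis using assms by (simp add: isometry_dist dist_commute)
qed

section \<open>Convex functions on a half-line\<close>

text \<open>\<open>b\<close> is the convex combination of \<open>a\<close> and \<open>t\<close> with
  weight \<open>u\<close> on \<open>t\<close>. Solving the convexity inequality for
  \<open>\<phi> t\<close> puts the graph above the chord prolonged beyond \<open>b\<close>.\<close>

lemma convex_on_growth:
  fixes \<phi> :: "real \<Rightarrow> real"
  assumes "convex_on {0..} \<phi>" "0 \<le> a" "a < b" "b \<le> t"
  shows "\<phi> a + (t - a) / (b - a) * (\<phi> b - \<phi> a) \<le> \<phi> t"
proof -
  define u where "u = (b - a) / (t - a)"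
  have u: "0 < u" "u \<le> 1" using assms by (auto simp: u_def)
  have "u * (t - a) = b - a" using assms by (simp add: u_def)
  then have "(1 - u) *\<^sub>R a + u *\<^sub>R t = b" by (simp add: algebra_simps)
  then have "\<phi> b \<le> (1 - u) * \<phi> a + u * \<phi> t"
    using convex_onD[OF assms(1), of u a t] assms u by auto
  then have "(\<phi> b - \<phi> a) / u \<le> \<phi> t - \<phi> a"
    using u by (simp add: field_simps)
  moreover have "(t - a) / (b - a) * (\<phi> b - \<phi> a) = (\<phi> b - \<phi> a) / u"
    by (simp add: u_def)
  ultimately show ?thesis by simp
qed

lemma convex_on_increase_mono:
  fixes \<phi> :: "real \<Rightarrow> real"
  assumes "convex_on {0..} \<phi>" "0 \<le> a" "a < b" "b \<le> t" "\<phi> a \<le> \<phi> b"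
  shows "\<phi> b \<le> \<phi> t"
proof -
  have "1 * (\<phi> b - \<phi> a) \<le> (t - a) / (b - a) * (\<phi> b - \<phi> a)"
    using assms by (intro mult_right_mono) auto
  then show ?thesis using convex_on_growth[OF assms(1-4)] by simp
qed

lemma convex_on_increase_unbounded:
  fixes \<phi> :: "real \<Rightarrow> real"
  assumes "convex_on {0..} \<phi>" "0 \<le> a" "a < b" "\<phi> a < \<phi> b"
  shows "\<exists>t\<ge>b. K < \<phi> t"
proof -
  \<comment> \<open>At this time the prolonged chord has reached height at least
    \<open>K + 1\<close>; the maximum ensures \<open>b \<le> t\<close>.\<close>
  define t where "t = max b (a + (b - a) * ((K - \<phi> a + 1) / (\<phi> b - \<phi> a)))"
  have "(b - a) * ((K - \<phi> a + 1) / (\<phi> b - \<phi> a)) \<le> t - a" by (simp add: t_def)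
  then have "(K - \<phi> a + 1) / (\<phi> b - \<phi> a) \<le> (t - a) / (b - a)"
    using assms by (simp add: field_simps)
  then have "K - \<phi> a + 1 \<le> (t - a) / (b - a) * (\<phi> b - \<phi> a)"
    using assms by (simp add: pos_divide_le_eq)
  moreover have "b \<le> t" by (simp add: t_def)
  ultimately show ?thesis using convex_on_growth[OF assms(1-3), of t]
    by (intro exI[of _ t]) auto
qed

text \<open>A strict increase would continue at least linearly and exceed the bound.\<close>

lemma convex_on_bounded_antimono:
  fixes \<phi> :: "real \<Rightarrow> real"
  assumes "convex_on {0..} \<phi>" "\<And>t. 0 \<le> t \<Longrightarrow> \<phi> t \<le> K" "0 \<le> a" "a \<le> b"
  shows "\<phi> b \<le> \<phi> a"
  using convex_on_increase_unbounded[OF assms(1,3), of b K] assms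
  by (metis dual_order.trans leD le_less_linear order_le_less)

section \<open>Cluster points of sequences of maps\<close>

text \<open>By Tychonoff the product of the \<open>K i\<close> is compact, so the sequence has a
  cluster point there. For an uncountable index type this need not give a convergent subsequence;
  control of two coordinates at once is enough to pass distances to the limit.\<close>

lemma pointwise_cluster_point:
  fixes u :: "nat \<Rightarrow> 'i \<Rightarrow> 'a::metric_space"
  assumes K: "\<And>i. compact (K i)" and u: "\<And>n i. u n i \<in> K i"
  shows "\<exists>g. \<forall>i j e N. 0 < e \<longrightarrow> (\<exists>n\<ge>N. dist (u n i) (g i) < e \<and> dist (u n j) (g j) < e)"
proof -
  have "compactin (product_topology (\<lambda>_. euclidean) UNIV) (PiE UNIV K)"
    using K by (simp add: compactin_PiE)
  then have "compact (PiE UNIV K)"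
    by (simp add: euclidean_product_topology)
  moreover have "filtermap u sequentially \<noteq> bot" 
    by (simp add: filtermap_bot_iff)
  moreover have "eventually (\<lambda>h. h \<in> PiE UNIV K) (filtermap u sequentially)"
    using u by (simp add: eventually_filtermap PiE_UNIV_domain)
  ultimately obtain g where g: "inf (nhds g) (filtermap u sequentially) \<noteq> bot"
    unfolding compact_filter by meson
  have "\<exists>n\<ge>N. dist (u n i) (g i) < e \<and> dist (u n j) (g j) < e" if "0 < e" for i j e N
  proof (rule ccontr)
    assume neg: "\<not> ?thesis"
    let ?O = "{h. dist (h i) (g i) < e \<and> dist (h j) (g j) < e}"
    have "open ?O"
      unfolding Collect_conj_eq
      by (intro open_Int open_Collect_less continuous_on_dist continuous_on_const
          continuous_on_product_coordinates)
    then have "eventually (\<lambda>h. h \<in> ?O) (nhds g)"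
      using that by (intro eventually_nhds_in_open) auto
    moreover have "eventually (\<lambda>h. h \<notin> ?O) (filtermap u sequentially)"
      using neg by (auto simp: eventually_filtermap eventually_sequentially)
    ultimately have "eventually (\<lambda>_. False) (inf (nhds g) (filtermap u sequentially))"
      unfolding eventually_inf by blast
    then show False using g by (simp add: trivial_limit_def)
  qed
  then show ?thesis by blast
qed

section \<open>Asymptotic rays and boundary points\<close>

lemma asymptotic_sym: "asymptotic c c' \<Longrightarrow> asymptotic c' c"
  by (simp add: asymptotic_def dist_commute)

lemma asymptotic_trans:
  assumes "asymptotic c d" "asymptotic d e"
  shows "asymptotic c e"
proof -
  obtain C D where "\<forall>t\<ge>0. dist (c t) (d t) \<le> C" "\<forall>t\<ge>0. dist (d t) (e t) \<le> D"
    using assms unfolding asymptotic_def by blast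
  then have "\<forall>t\<ge>0. dist (c t) (e t) \<le> C + D"
    by (meson add_mono dist_triangle order_trans)
  then show ?thesis unfolding asymptotic_def by blast
qed

lemma asymptotic_isometry: "isometry g \<Longrightarrow> asymptotic c d \<Longrightarrow> asymptotic (g \<circ> c) (g \<circ> d)"
  by (simp add: asymptotic_def isometry_dist)

lemma ray_class_self: "geodesic_ray c \<Longrightarrow> c \<in> ray_class c"
  unfolding ray_class_def asymptotic_def by (auto intro: exI[of _ 0])

lemma ray_class_eq: "asymptotic c c' \<Longrightarrow> ray_class c = ray_class c'"
  unfolding ray_class_def by (auto intro: asymptotic_trans asymptotic_sym)

lemma ray_class_in_vis_bdry: "geodesic_ray c \<Longrightarrow> ray_class c \<in> vis_bdry"
  unfolding vis_bdry_def by blast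

lemma vis_bdry_member:
  assumes "\<xi> \<in> vis_bdry" "c \<in> \<xi>"
  shows "geodesic_ray c" "\<xi> = ray_class c"
proof -
  obtain d where "\<xi> = ray_class d" using assms(1) unfolding vis_bdry_def by blast
  moreover from this assms(2) have "geodesic_ray c" "asymptotic d c" by (auto simp: ray_class_def)
  ultimately show "geodesic_ray c" "\<xi> = ray_class c" using ray_class_eq by blast+
qed

section \<open>Sides of a fixed-point set\<close>

text \<open>Records the open splitting of the complement of the fixed-point set in a form that is
  symmetric in \<open>A\<close> and \<open>B\<close> and passes to conjugates of
  \<open>r\<close>.\<close>

definition separates :: "('a::metric_space \<Rightarrow> 'a) \<Rightarrow> 'a set \<Rightarrow> 'a set \<Rightarrow> bool" where
  "separates r A B \<longleftrightarrow>
     isometry r \<and> open A \<and> open B \<and> A \<inter> B = {} \<and> A \<union> B = - {x. r x = x}"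

text \<open>Unbounded displacement expresses that the ray does not end in the boundary of the
  fixed-point set. One representative is asked for; \<open>bdry_sideD\<close> transfers the
  information to all of them.\<close>

definition bdry_side :: "('a::metric_space \<Rightarrow> 'a) \<Rightarrow> 'a set \<Rightarrow> (real \<Rightarrow> 'a) set set" where
  "bdry_side r A = {\<xi> \<in> vis_bdry. \<exists>c\<in>\<xi>.
     (\<forall>K. \<exists>t\<ge>0. K < dist (c t) (r (c t))) \<and> (\<exists>T\<ge>0. \<forall>t\<ge>T. c t \<in> A)}"

lemma separates_commute: "separates r A B \<Longrightarrow> separates r B A"
  unfolding separates_def by blast

lemma connected_subset_side:
  assumes "separates r A B" "connected S" "x \<in> S" "x \<in> A" "\<And>y. y \<in> S \<Longrightarrow> r y \<noteq> y"
  shows "S \<subseteq> A"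
proof -
  have "S \<subseteq> A \<union> B" using assms(1,5) unfolding separates_def by blast
  then have "A \<inter> S = {} \<or> B \<inter> S = {}"
    using assms(1,2) connectedD[of S A B] unfolding separates_def by blast
  then show ?thesis using \<open>S \<subseteq> A \<union> B\<close> assms(3,4) by blast
qed

lemma separates_conjugate:
  assumes "separates r A B" "isometry g"
  shows "separates (g \<circ> r \<circ> inv g) (g ` A) (g ` B)"
proof -
  \<comment> \<open>Images under \<open>g\<close> become preimages under the continuous inverse,
    which preserve openness and disjointness.\<close>
  have img: "g ` S = inv g -` S" for S
    using assms(2) by (auto simp: isometry_inv_f intro: image_eqI[OF isometry_f_inv[symmetric]])
  have op: "open (g ` S)" if "open S" for S
    unfolding img by (intro open_vimage that isometry_continuous_on isometry_inv assms(2))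
  have "x \<in> A \<or> x \<in> B \<longleftrightarrow> r x \<noteq> x" for x using assms(1) unfolding separates_def by blast
  moreover have "g (r (inv g x)) = x \<longleftrightarrow> r (inv g x) = inv g x" for x
    using assms(2) isometry_inv_f isometry_f_inv by metis
  ultimately have "g ` A \<union> g ` B = - {x. (g \<circ> r \<circ> inv g) x = x}"
    unfolding img by auto
  moreover have "g ` A \<inter> g ` B = {}" using assms(1) unfolding img separates_def by auto
  ultimately show ?thesis using assms op unfolding separates_def by (auto intro!: isometry_comp isometry_inv simp del: comp_apply)
qed

text \<open>A ray within distance \<open>C\<close> of a ray of fixed points has displacement at most
  \<open>2 * C\<close>.\<close>

lemma bdry_side_disjoint_bdry_fixpoints:
  assumes "\<xi> \<in> bdry_of {x. r x = x}" "isometry r"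
  shows "\<xi> \<notin> bdry_side r A"
proof
  assume "\<xi> \<in> bdry_side r A"
  then obtain c where c: "c \<in> \<xi>" "\<xi> \<in> vis_bdry" "\<forall>K. \<exists>t\<ge>0. K < dist (c t) (r (c t))"
    unfolding bdry_side_def by blast
  obtain d where d: "d \<in> \<xi>" "d ` {0..} \<subseteq> {x. r x = x}" using assms(1) unfolding bdry_of_def by blast
  then obtain C where C: "\<forall>t\<ge>0. dist (c t) (d t) \<le> C"
    using c vis_bdry_member[of \<xi> c] unfolding ray_class_def asymptotic_def by blast
  obtain t where t: "t \<ge> 0" "2 * C < dist (c t) (r (c t))" using c by blast
  have "dist (c t) (r (c t)) \<le> dist (d t) (r (d t)) + 2 * dist (c t) (d t)"
    by (rule displacement_le[OF assms(2)])
  moreover have "r (d t) = d t" using d(2) t by auto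
  ultimately show False using C t by fastforce
qed

section \<open>Convexity of the distance in CAT(0) spaces\<close>

locale proper_CAT0 =
  fixes X :: "'a::metric_space itself"
  assumes proper: "proper_space TYPE('a)" and CAT0: "CAT0 TYPE('a)"
begin

lemma geodesic_exists: "\<exists>c. geodesic_seg c x (y::'a)"
  using CAT0 unfolding CAT0_def geodesic_space_def by blast

text \<open>The diagonal \<open>\<rho>\<close> from \<open>p\<close> to \<open>q'\<close> cuts the
  quadrilateral into two triangles. The second one is compared from its vertex \<open>q'\<close>,
  hence with ratio \<open>1 - s\<close>.\<close>

lemma geodesics_dist_convex:
  fixes p q p' q' :: 'a
  assumes \<sigma>: "geodesic_seg \<sigma> p q" and \<tau>: "geodesic_seg \<tau> p' q'" and s: "0 \<le> s" "s \<le> 1"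
  shows "dist (\<sigma> (s * dist p q)) (\<tau> (s * dist p' q')) \<le> (1 - s) * dist p p' + s * dist q q'"
proof -
  obtain \<rho> where \<rho>: "geodesic_seg \<rho> p q'" using geodesic_exists by blast
  have "dist (\<sigma> (s * dist p q)) (\<rho> (s * dist p q')) \<le> s * dist q q'"
    by (rule CAT0_dist_scaled[OF CAT0 \<sigma> \<rho> s])
  moreover have "dist (\<rho> (dist p q' - (1 - s) * dist q' p)) (\<tau> (dist p' q' - (1 - s) * dist q' p'))
      \<le> (1 - s) * dist p p'"
    using s by (intro CAT0_dist_scaled[OF CAT0 geodesic_seg_reverse[OF \<rho>] geodesic_seg_reverse[OF \<tau>]]) auto
  then have "dist (\<rho> (s * dist p q')) (\<tau> (s * dist p' q')) \<le> (1 - s) * dist p p'"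
    by (simp add: algebra_simps dist_commute)
  ultimately show ?thesis
    using dist_triangle[of "\<sigma> (s * dist p q)" "\<tau> (s * dist p' q')" "\<rho> (s * dist p q')"] by linarith
qed

lemma geodesic_unique:
  fixes p q :: 'a
  assumes "geodesic_seg \<sigma> p q" "geodesic_seg \<tau> p q" "0 \<le> t" "t \<le> dist p q"
  shows "\<sigma> t = \<tau> t"
proof (cases "p = q")
  case True
  then show ?thesis using assms by (simp add: geodesic_seg_def)
next
  case False
  then show ?thesis
    using geodesics_dist_convex[OF assms(1,2), of "t / dist p q"] assms(3,4) by simp
qed

text \<open>Comparison controls points at equal ratio \<open>s\<close>. Passing to equal arc length
  on the second geodesic costs at most \<open>s * dist q q'\<close> once more, whence the factor
  2.\<close>

lemma geodesics_dist_at_time: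
  fixes p q q' :: 'a
  assumes \<sigma>: "geodesic_seg \<sigma> p q" and \<tau>: "geodesic_seg \<tau> p q'"
    and t: "0 \<le> t" "t \<le> dist p q" "t \<le> dist p q'" and pos: "0 < dist p q"
  shows "dist (\<sigma> t) (\<tau> t) \<le> 2 * t * dist q q' / dist p q"
proof -
  define s where "s = t / dist p q"
  have s: "0 \<le> s" "s \<le> 1" "s * dist p q = t" using t pos by (auto simp: s_def)
  have "dist (\<sigma> t) (\<tau> (s * dist p q')) \<le> s * dist q q'"
    using CAT0_dist_scaled[OF CAT0 \<sigma> \<tau> s(1,2)] s(3) by simp
  moreover have "dist (\<tau> (s * dist p q')) (\<tau> t) = \<bar>s * dist p q' - t\<bar>"
    using \<tau> t s unfolding geodesic_seg_def by (simp add: mult_left_le_one_le)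
  moreover have "\<bar>s * dist p q' - t\<bar> = s * \<bar>dist p q' - dist p q\<bar>"
    using s by (metis abs_mult abs_of_nonneg right_diff_distrib)
  moreover have "\<bar>dist p q' - dist p q\<bar> \<le> dist q q'"
    using dist_triangle[of p q' q] dist_triangle[of p q q'] by (simp add: dist_commute abs_le_iff)
  then have "s * \<bar>dist p q' - dist p q\<bar> \<le> s * dist q q'" using s by (intro mult_left_mono)
  ultimately have "dist (\<sigma> t) (\<tau> t) \<le> s * dist q q' + s * dist q q'"
    by (smt (verit) dist_triangle)
  then show ?thesis by (simp add: s_def)
qed

lemma displacement_convex_segment:
  fixes p q :: 'a
  assumes "isometry g" "geodesic_seg \<sigma> p q" "0 \<le> s" "s \<le> 1"
  shows "dist (\<sigma> (s * dist p q)) (g (\<sigma> (s * dist p q))) \<le> (1 - s) * dist p (g p) + s * dist q (g q)"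
  using geodesics_dist_convex[OF assms(2) geodesic_seg_isometry[OF assms(1,2)] assms(3,4)]
  by (simp add: isometry_dist[OF assms(1)])

lemma rays_dist_convex:
  fixes c c' :: "real \<Rightarrow> 'a"
  assumes c: "geodesic_ray c" and c': "geodesic_ray c'"
  shows "convex_on {0..} (\<lambda>t. dist (c t) (c' t))"
proof (rule convex_on_linorderI)
  fix t x y :: real
  assume t: "0 < t" "t < 1" and xy: "x \<in> {0..}" "y \<in> {0..}" "x < y"
  have "dist (c x) (c y) = y - x" "dist (c' x) (c' y) = y - x"
    using c c' xy unfolding geodesic_ray_def by auto
  then have "dist (c (x + t * (y - x))) (c' (x + t * (y - x)))
      \<le> (1 - t) * dist (c x) (c' x) + t * dist (c y) (c' y)"
    using geodesics_dist_convex[OF geodesic_ray_segment[OF c, of x y] geodesic_ray_segment[OF c', of x y], of t]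
      t xy by simp
  moreover have "(1 - t) *\<^sub>R x + t *\<^sub>R y = x + t * (y - x)" by (simp add: algebra_simps)
  ultimately show "dist (c ((1 - t) *\<^sub>R x + t *\<^sub>R y)) (c' ((1 - t) *\<^sub>R x + t *\<^sub>R y))
      \<le> (1 - t) * dist (c x) (c' x) + t * dist (c y) (c' y)" by simp
qed simp

lemma ray_displacement_convex:
  fixes c :: "real \<Rightarrow> 'a"
  assumes "geodesic_ray c" "isometry g"
  shows "convex_on {0..} (\<lambda>t. dist (c t) (g (c t)))"
  using rays_dist_convex[OF assms(1) geodesic_ray_isometry[OF assms(2,1)]] by simp

lemma asymptotic_rays_dist_antimono:
  fixes c c' :: "real \<Rightarrow> 'a"
  assumes "geodesic_ray c" "geodesic_ray c'" "asymptotic c c'" "0 \<le> a" "a \<le> b"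
  shows "dist (c b) (c' b) \<le> dist (c a) (c' a)"
  using assms(3) convex_on_bounded_antimono[OF rays_dist_convex[OF assms(1,2)] _ assms(4,5)]
  unfolding asymptotic_def by blast

lemma asymptotic_rays_eq:
  fixes c c' :: "real \<Rightarrow> 'a"
  assumes "geodesic_ray c" "geodesic_ray c'" "asymptotic c c'" "c 0 = c' 0" "0 \<le> t"
  shows "c t = c' t"
  using asymptotic_rays_dist_antimono[OF assms(1-3) order_refl assms(5)] assms(4) by simp

section \<open>Rays from a prescribed point to a boundary point\<close>

text \<open>The new ray is a cluster point of the segments from \<open>p\<close> to
  \<open>c (real n)\<close>. Properness supplies the compact balls, and convexity of the distance
  keeps the segments close to \<open>c\<close>.\<close>

lemma asymptotic_ray_exists:
  fixes c :: "real \<Rightarrow> 'a"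
  assumes c: "geodesic_ray c"
  shows "\<exists>c'. geodesic_ray c' \<and> c' 0 = p \<and> asymptotic c c'"
proof -
  define D where "D = dist p (c 0)"
  define l where "l n = dist p (c (real n))" for n
  obtain \<sigma> where \<sigma>: "\<And>n. geodesic_seg (\<sigma> n) p (c (real n))"
    using choice[of "\<lambda>n s. geodesic_seg s p (c (real n))"] geodesic_exists by blast
  have cn: "dist (c 0) (c (real n)) = real n" for n using c unfolding geodesic_ray_def by auto
  have l: "\<bar>l n - real n\<bar> \<le> D" for n
    using dist_triangle[of p "c (real n)" "c 0"] dist_triangle[of "c 0" "c (real n)" p] cn[of n]
    unfolding l_def D_def by (simp add: dist_commute abs_le_iff)
  \<comment> \<open>The default \<open>p\<close> keeps \<open>u n t\<close> in the ball of radius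
    \<open>\<bar>t\<bar>\<close> about \<open>p\<close> also where the segment is not
    defined.\<close>
  define u where "u n t = (if 0 \<le> t \<and> t \<le> l n then \<sigma> n t else p)" for n t
  have "u n t \<in> cball p \<bar>t\<bar>" for n t
    using geodesic_seg_dist_start[OF \<sigma>] by (simp add: u_def l_def)
  then obtain g where g: "\<And>s t e N. 0 < e \<Longrightarrow>
      \<exists>n\<ge>N. dist (u n s) (g s) < e \<and> dist (u n t) (g t) < e"
    using pointwise_cluster_point[of "\<lambda>t. cball p \<bar>t\<bar>" u] proper unfolding proper_space_def by blast
  have u\<sigma>: "u n t = \<sigma> n t" if "0 \<le> t" "nat \<lceil>t + D\<rceil> \<le> n" for n t
  proof -
    have "t + D \<le> real n" using that(2) by linarith
    then have "t \<le> l n" using l[of n] by linarith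
    then show ?thesis using that(1) by (simp add: u_def)
  qed
  have iso: "dist (g s) (g t) = \<bar>s - t\<bar>" if "0 \<le> s" "0 \<le> t" for s t
  proof -
    have "\<bar>dist (g s) (g t) - \<bar>s - t\<bar>\<bar> \<le> e" if "0 < e" for e
    proof -
      obtain n where n: "nat \<lceil>max s t + D\<rceil> \<le> n" "dist (u n s) (g s) < e / 2" "dist (u n t) (g t) < e / 2"
        using g[of "e / 2" "nat \<lceil>max s t + D\<rceil>" s t] \<open>0 < e\<close> by auto
      have st: "s + D \<le> real n" "t + D \<le> real n" using n(1) by linarith+
      have "dist (u n s) (u n t) = \<bar>s - t\<bar>"
      proof -
        have "s \<le> l n" "t \<le> l n" using st l[of n] by linarith+
        then show ?thesis
          using \<sigma>[of n] \<open>0 \<le> s\<close> \<open>0 \<le> t\<close> unfolding u_def geodesic_seg_def l_def by auto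
      qed
      moreover have "\<bar>dist (g s) (g t) - dist (u n s) (u n t)\<bar> \<le> dist (u n s) (g s) + dist (u n t) (g t)"
        by (smt (verit) dist_commute dist_triangle)
      ultimately show ?thesis using n by linarith
    qed
    then have "\<bar>dist (g s) (g t) - \<bar>s - t\<bar>\<bar> \<le> 0" by (rule field_le_epsilon[of _ 0, simplified])
    then show ?thesis by simp
  qed
  then have ray: "geodesic_ray g" unfolding geodesic_ray_def by blast
  have "g 0 = p"
  proof -
    have "dist p (g 0) \<le> e" if "0 < e" for e
      using g[OF that, of 0 0 0] \<sigma> by (auto simp: u_def geodesic_seg_def less_imp_le split: if_splits)
    then show ?thesis using field_le_epsilon[of "dist p (g 0)" 0] by simp
  qed
  moreover have "dist (c t) (g t) \<le> 2 * D + 1" if t: "0 \<le> t" for t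
  proof -
    \<comment> \<open>The added 1 keeps \<open>n\<close> positive when \<open>t + D\<close> is 0, so
      that the ratio \<open>t / real n\<close> makes sense.\<close>
    obtain n where n: "nat \<lceil>t + D\<rceil> + 1 \<le> n" "dist (u n t) (g t) < 1"
      using g[of 1 "nat \<lceil>t + D\<rceil> + 1" t t] by auto
    have "t + D \<le> real n" "0 < real n" using n(1) by linarith+
    define s where "s = t / real n"
    have D: "0 \<le> D" by (simp add: D_def)
    have s: "0 \<le> s" "s \<le> 1" "s * real n = t"
      using \<open>t + D \<le> real n\<close> \<open>0 < real n\<close> t D by (auto simp: s_def)
    \<comment> \<open>The point at ratio \<open>s\<close> on the segment is within
      \<open>(1 - s) * D\<close> of \<open>c t\<close>, and its arc length differs from
      \<open>t\<close> by at most \<open>s * D\<close>. Together these give at most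
      \<open>D\<close>, apart from the approximation of \<open>g t\<close>.\<close>
    have "dist (\<sigma> n (s * l n)) (c (s * dist (c 0) (c (real n)))) \<le> (1 - s) * D + s * 0"
      using geodesics_dist_convex[OF \<sigma>[of n] geodesic_ray_initial_segment[OF c, of "real n"] s(1,2)]
      by (simp add: l_def D_def)
    then have 1: "dist (\<sigma> n (s * l n)) (c t) \<le> (1 - s) * D" using s(3) cn by simp
    have "t \<le> l n" using l[of n] \<open>t + D \<le> real n\<close> by linarith
    have ln: "0 \<le> l n" by (simp add: l_def)
    have "dist (\<sigma> n (s * l n)) (\<sigma> n t) = \<bar>s * l n - t\<bar>"
      using \<sigma>[of n] s t \<open>t \<le> l n\<close> ln unfolding geodesic_seg_def l_def[symmetric]
      by (simp add: mult_left_le_one_le)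
    also have "\<dots> = s * \<bar>l n - real n\<bar>"
      using s by (metis abs_mult abs_of_nonneg right_diff_distrib)
    also have "\<dots> \<le> s * D" using l[of n] s by (intro mult_left_mono)
    finally have 2: "dist (\<sigma> n (s * l n)) (\<sigma> n t) \<le> s * D" .
    have "u n t = \<sigma> n t" using n(1) by (intro u\<sigma>[OF t]) linarith
    then have "dist (c t) (g t) \<le> dist (\<sigma> n (s * l n)) (c t) + dist (\<sigma> n (s * l n)) (\<sigma> n t) + dist (u n t) (g t)"
      by (smt (verit) dist_commute dist_triangle)
    then show ?thesis using 1 2 n(2) D by (simp add: algebra_simps)
  qed
  ultimately show ?thesis using ray unfolding asymptotic_def by blast
qed

lemma bdry_ray_from:
  assumes "\<xi> \<in> (vis_bdry :: (real \<Rightarrow> 'a) set set)"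
  shows "\<exists>c\<in>\<xi>. c 0 = p"
proof -
  obtain d where "\<xi> = ray_class d" "geodesic_ray d" using assms unfolding vis_bdry_def by blast
  then show ?thesis using asymptotic_ray_exists[of d p] unfolding ray_class_def by blast
qed

lemma geo_convex_connected:
  assumes "geo_convex (S :: 'a set)"
  shows "connected S"
proof (cases "S = {}")
  case False
  then obtain x where x: "x \<in> S" by blast
  obtain c where c: "\<And>y. geodesic_seg (c y) x y" using geodesic_exists by metis
  define I where "I y = c y ` {0..dist x y}" for y
  have mem: "x \<in> I y" "y \<in> I y" for y
    using c[of y] unfolding I_def geodesic_seg_def by (metis atLeastAtMost_iff image_eqI order_refl zero_le_dist)+
  have "connected (I y)" for y
    unfolding I_def by (intro connected_continuous_image geodesic_seg_continuous_on[OF c] connected_Icc)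
  then have "connected (\<Union> (I ` S))"
    using mem(1) by (intro connected_Union) blast+
  moreover have "I y \<subseteq> S" if "y \<in> S" for y
    using assms x that c unfolding geo_convex_def I_def by blast
  then have "\<Union> (I ` S) = S" using mem(2) by blast
  ultimately show ?thesis by simp
qed simp

section \<open>The two sides of the boundary\<close>

text \<open>A fixed point on the geodesic from \<open>x\<close> to \<open>z\<close> would be within
  \<open>C\<close> of \<open>x\<close> and bound its displacement by \<open>2 * C\<close>. So the
  geodesic misses the fixed-point set and cannot change sides.\<close>

lemma near_deep_point_same_side:
  assumes "separates r A B" "(x::'a) \<in> A" "dist x z \<le> C" "2 * C < dist x (r x)"
  shows "z \<in> A"
proof -
  obtain c where c: "geodesic_seg c x z" using geodesic_exists by blast
  have iso: "isometry r" using assms(1) by (simp add: separates_def)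
  have "c ` {0..dist x z} \<subseteq> A"
  proof (rule connected_subset_side[OF assms(1) _ _ assms(2)])
    show "connected (c ` {0..dist x z})"
      by (intro connected_continuous_image geodesic_seg_continuous_on[OF c] connected_Icc)
    show "x \<in> c ` {0..dist x z}"
      using c unfolding geodesic_seg_def by (metis atLeastAtMost_iff image_eqI order_refl zero_le_dist)
    show "r y \<noteq> y" if "y \<in> c ` {0..dist x z}" for y
    proof
      assume "r y = y"
      moreover have "dist x y \<le> dist x z" using that geodesic_seg_dist_start[OF c] by auto
      ultimately show False using displacement_le[OF iso, of x y] assms(3,4) by simp
    qed
  qed
  moreover have "z \<in> c ` {0..dist x z}"
    using c unfolding geodesic_seg_def by (metis atLeastAtMost_iff image_eqI order_refl zero_le_dist)
  ultimately show ?thesis by blast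
qed

text \<open>Displacement along the ray is convex, so one strict increase makes it unbounded and
  keeps it positive from \<open>b\<close> on; the tail never meets the fixed-point set and stays on
  the side of \<open>c b\<close>. A condition at infinity is thus tested at two times.\<close>

lemma bdry_sideI:
  fixes c :: "real \<Rightarrow> 'a"
  assumes sep: "separates r A B" and c: "geodesic_ray c" and ab: "0 \<le> a" "a < b"
    and less: "dist (c a) (r (c a)) < dist (c b) (r (c b))" and A: "c b \<in> A"
  shows "ray_class c \<in> bdry_side r A"
proof -
  have iso: "isometry r" using sep by (simp add: separates_def)
  note conv = ray_displacement_convex[OF c iso]
  have "\<exists>t\<ge>0. K < dist (c t) (r (c t))" for K
    using convex_on_increase_unbounded[OF conv ab less, of K] ab by (meson less_le_trans less_imp_le order_trans)
  moreover have "c ` {b..} \<subseteq> A"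
  proof (rule connected_subset_side[OF sep _ _ A])
    have "continuous_on {b..} c"
      using ab by (intro continuous_on_subset[OF geodesic_ray_continuous_on[OF c]]) auto
    then show "connected (c ` {b..})" by (intro connected_continuous_image) auto
    show "c b \<in> c ` {b..}" by simp
    show "r y \<noteq> y" if "y \<in> c ` {b..}" for y
    proof -
      obtain t where "y = c t" "b \<le> t" using \<open>y \<in> c ` {b..}\<close> by auto
      then have "dist (c b) (r (c b)) \<le> dist y (r y)"
        using convex_on_increase_mono[OF conv ab] less by auto
      then show ?thesis using less by (metis dist_self leD le_less_trans zero_le_dist)
    qed
  qed
  ultimately have "(\<forall>K. \<exists>t\<ge>0. K < dist (c t) (r (c t))) \<and> (\<exists>T\<ge>0. \<forall>t\<ge>T. c t \<in> A)"
    using ab by (auto intro!: exI[of _ b])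
  then show ?thesis
    using ray_class_self[OF c] ray_class_in_vis_bdry[OF c] unfolding bdry_side_def by blast
qed

lemma bdry_sideD:
  fixes c :: "real \<Rightarrow> 'a"
  assumes sep: "separates r A B" and \<xi>: "\<xi> \<in> bdry_side r A" and c: "c \<in> \<xi>"
  shows "\<exists>t>0. K < dist (c t) (r (c t)) \<and> c t \<in> A"
proof -
  have iso: "isometry r" using sep by (simp add: separates_def)
  obtain d T where d: "d \<in> \<xi>" "\<forall>K. \<exists>t\<ge>0. K < dist (d t) (r (d t))"
      and T: "0 \<le> T" "\<forall>t\<ge>T. d t \<in> A" and vis: "\<xi> \<in> vis_bdry"
    using \<xi> unfolding bdry_side_def by blast
  have dray: "geodesic_ray d" and "\<xi> = ray_class d" using vis_bdry_member[OF vis d(1)] by auto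
  then obtain C where C: "\<forall>t\<ge>0. dist (d t) (c t) \<le> C"
    using c unfolding ray_class_def asymptotic_def by blast
  note conv = ray_displacement_convex[OF dray iso]
  obtain t1 where t1: "t1 \<ge> 0" "dist (d 0) (r (d 0)) < dist (d t1) (r (d t1))" using d(2) by blast
  then have "t1 > 0" by (metis less_irrefl order_le_less)
  then have "dist (d t1) (r (d t1)) \<le> dist (d (max t1 T)) (r (d (max t1 T)))"
    using convex_on_increase_mono[OF conv order_refl, of t1 "max t1 T"] t1 by simp
  with t1 have "dist (d 0) (r (d 0)) < dist (d (max t1 T)) (r (d (max t1 T)))" by linarith
  \<comment> \<open>Since \<open>c\<close> stays within \<open>C\<close> of \<open>d\<close>, the
    bound \<open>2 * C\<close> puts \<open>c t\<close> on the side of \<open>d t\<close>, and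
    \<open>K + 2 * C\<close> leaves displacement above \<open>K\<close> at
    \<open>c t\<close>.\<close>
  then obtain t where t: "max t1 T \<le> t" "max (K + 2 * C) (2 * C) < dist (d t) (r (d t))"
    using convex_on_increase_unbounded[OF conv order_refl, of "max t1 T" "max (K + 2 * C) (2 * C)"]
      \<open>t1 > 0\<close> by (meson less_max_iff_disj)
  have "dist (d t) (c t) \<le> C" using C t \<open>t1 > 0\<close> by auto
  moreover have "d t \<in> A" using T t by auto
  ultimately have "c t \<in> A" using near_deep_point_same_side[OF sep, of "d t" "c t" C] t by simp
  moreover have "K < dist (c t) (r (c t))"
    using displacement_le[OF iso, of "d t" "c t"] \<open>dist (d t) (c t) \<le> C\<close> t by simp
  ultimately show ?thesis using t \<open>t1 > 0\<close> by (intro exI[of _ t]) auto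
qed

text \<open>Up to time \<open>T\<close> the displacement exceeds its initial value by at most
  \<open>2 * T\<close>. A point of \<open>B\<close> with larger displacement therefore comes after
  \<open>T\<close>, when the ray is already in \<open>A\<close>.\<close>

lemma bdry_sides_disjoint:
  assumes sep: "separates (r :: 'a \<Rightarrow> 'a) A B"
  shows "bdry_side r A \<inter> bdry_side r B = {}"
proof -
  have False if \<xi>: "\<xi> \<in> bdry_side r A" "\<xi> \<in> bdry_side r B" for \<xi>
  proof -
    have iso: "isometry r" using sep by (simp add: separates_def)
    obtain c T where c: "c \<in> \<xi>" and T: "0 \<le> T" "\<forall>t\<ge>T. c t \<in> A" and vis: "\<xi> \<in> vis_bdry"
      using \<xi>(1) unfolding bdry_side_def by blast
    obtain t where t: "0 < t" "dist (c 0) (r (c 0)) + 2 * T < dist (c t) (r (c t))" "c t \<in> B"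
      using bdry_sideD[OF separates_commute[OF sep] \<xi>(2) c] by blast
    have "dist (c t) (c 0) = t"
      using vis_bdry_member(1)[OF vis c] t(1) unfolding geodesic_ray_def by simp
    then have "T \<le> t" using displacement_le[OF iso, of "c t" "c 0"] t by simp
    then show False using T t(3) sep unfolding separates_def by blast
  qed
  then show ?thesis by blast
qed

text \<open>By \<open>bdry_sideI\<close>, membership is witnessed by \<open>c t\<close> lying in the
  open set \<open>A\<close> with displacement larger than at \<open>x0\<close>. Both conditions
  survive a small change of \<open>c t\<close>.\<close>

lemma openin_bdry_side:
  assumes sep: "separates (r :: 'a \<Rightarrow> 'a) A B"
  shows "openin (cone_topology x0) (bdry_side r A)"
proof (subst openin_subopen, intro ballI)
  have iso: "isometry r" using sep by (simp add: separates_def)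
  fix \<xi> assume \<xi>: "\<xi> \<in> bdry_side r A"
  then have vis: "\<xi> \<in> vis_bdry" by (simp add: bdry_side_def)
  then obtain c where c: "c \<in> \<xi>" "c 0 = x0" using bdry_ray_from by blast
  have ray: "geodesic_ray c" using vis_bdry_member[OF vis c(1)] by simp
  obtain t where t: "0 < t" "dist x0 (r x0) < dist (c t) (r (c t))" "c t \<in> A"
    using bdry_sideD[OF sep \<xi> c(1)] by blast
  have "open A" using sep by (simp add: separates_def)
  then obtain d where d: "0 < d" "ball (c t) d \<subseteq> A" using t(3) openE by blast
  \<comment> \<open>Half the gap is taken because displacement is 2-Lipschitz.\<close>
  define e where "e = min d ((dist (c t) (r (c t)) - dist x0 (r x0)) / 2)"
  have e: "0 < e" "e \<le> d" "2 * e \<le> dist (c t) (r (c t)) - dist x0 (r x0)"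
    using d(1) t(2) by (auto simp: e_def min_def)
  have "cone_nbhd x0 c t e \<subseteq> bdry_side r A"
  proof
    fix \<eta> assume "\<eta> \<in> cone_nbhd x0 c t e"
    then obtain c' where \<eta>: "\<eta> \<in> vis_bdry" "c' \<in> \<eta>" "c' 0 = x0" "dist (c' t) (c t) < e"
      unfolding cone_nbhd_def by blast
    have ray': "geodesic_ray c'" "\<eta> = ray_class c'" using vis_bdry_member[OF \<eta>(1,2)] by auto
    have "c' t \<in> A" using \<eta>(4) e d by (auto simp: dist_commute)
    moreover have "dist (c' 0) (r (c' 0)) < dist (c' t) (r (c' t))"
      using displacement_le[OF iso, of "c t" "c' t"] \<eta>(3,4) e by (simp add: dist_commute)
    ultimately show "\<eta> \<in> bdry_side r A"
      using bdry_sideI[OF sep ray'(1) order_refl t(1)] ray'(2) by simp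
  qed
  moreover have "\<xi> \<in> cone_nbhd x0 c t e" using vis c e unfolding cone_nbhd_def by auto
  moreover have "openin (cone_topology x0) (cone_nbhd x0 c t e)"
    unfolding cone_topology_def openin_topology_generated_by_iff
    using ray c t e by (intro generate_topology_on.Basis) blast
  ultimately show "\<exists>T. openin (cone_topology x0) T \<and> \<xi> \<in> T \<and> T \<subseteq> bdry_side r A" by blast
qed

text \<open>If the displacement stays bounded along a ray, then \<open>r\<close> fixes its class, hence also the unique
  representative issuing from a fixed point of \<open>r\<close>.\<close>

lemma displacement_unbounded:
  fixes c :: "real \<Rightarrow> 'a"
  assumes iso: "isometry r" and p: "r p = p" and c: "geodesic_ray c"
    and nin: "ray_class c \<notin> bdry_of {x. r x = x}"
  shows "\<exists>t\<ge>0. K < dist (c t) (r (c t))"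
proof (rule ccontr)
  assume "\<not> ?thesis"
  then have asy: "asymptotic c (r \<circ> c)" unfolding asymptotic_def by (auto simp: not_less)
  obtain d where d: "geodesic_ray d" "d 0 = p" "asymptotic c d" using asymptotic_ray_exists[OF c] by blast
  have "asymptotic d (r \<circ> d)"
    using d(3) asy asymptotic_isometry[OF iso d(3)] asymptotic_trans asymptotic_sym by metis
  then have "d t = (r \<circ> d) t" if "0 \<le> t" for t
    using asymptotic_rays_eq[OF d(1) geodesic_ray_isometry[OF iso d(1)]] d(2) p that by simp
  then have "d ` {0..} \<subseteq> {x. r x = x}" by auto
  moreover have "d \<in> ray_class c" using d by (simp add: ray_class_def)
  ultimately show False using nin ray_class_in_vis_bdry[OF c] unfolding bdry_of_def by blast
qed

text \<open>The displacement is unbounded, so it exceeds its initial value at some time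
  \<open>t\<close>. Then \<open>c t\<close> is not fixed, and the side containing it decides by
  \<open>bdry_sideI\<close>.\<close>

lemma bdry_sides_cover:
  assumes sep: "separates (r :: 'a \<Rightarrow> 'a) A B" and p: "r p = p"
    and \<xi>: "\<xi> \<in> vis_bdry" "\<xi> \<notin> bdry_of {x. r x = x}"
  shows "\<xi> \<in> bdry_side r A \<union> bdry_side r B"
proof -
  have iso: "isometry r" using sep by (simp add: separates_def)
  obtain c where c: "geodesic_ray c" "\<xi> = ray_class c" using \<xi>(1) unfolding vis_bdry_def by blast
  obtain t where t: "0 \<le> t" "dist (c 0) (r (c 0)) < dist (c t) (r (c t))"
    using displacement_unbounded[OF iso p c(1)] \<xi>(2) c(2) by blast
  then have "0 < t" by (metis less_irrefl order_le_less)
  have "r (c t) \<noteq> c t" using t(2) by (metis dist_self not_less zero_le_dist)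
  then have "c t \<in> A \<or> c t \<in> B" using sep unfolding separates_def by blast
  then show ?thesis
    using bdry_sideI[OF sep c(1) order_refl \<open>0 < t\<close> t(2)]
      bdry_sideI[OF separates_commute[OF sep] c(1) order_refl \<open>0 < t\<close> t(2)] c(2) by blast
qed

section \<open>Reflections\<close>

lemma reflection_separates:
  assumes "reflection (r :: 'a \<Rightarrow> 'a)"
  obtains A B p where "separates r A B" "r ` A = B" "r ` B = A" "r p = p"
proof -
  let ?F = "{x. r x = x}"
  have iso: "isometry r" and inv: "r \<circ> r = id" using assms by (simp_all add: reflection_def)
  have "\<exists>A B. A \<noteq> B \<and> components (- ?F) = {A, B} \<and> r ` A = B"
    using assms unfolding reflection_def by (elim conjE ex_forward) simp
  then obtain A B where AB: "A \<noteq> B" "components (- ?F) = {A, B}" "r ` A = B"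
    by (elim exE conjE)
  have cov: "A \<union> B = - ?F" using AB(2) Union_components[of "- ?F"] by simp
  have disj: "A \<inter> B = {}" using AB(1,2) components_nonoverlap[of A "- ?F" B] by simp
  have "open (- ?F)" using closed_fixpoints_isometry[OF iso] by (simp add: open_Compl)
  \<comment> \<open>A component is closed in the complement of the fixed-point set. As there are
    exactly two, each is the relative complement of the other and hence open.\<close>
  have op: "open C" if "C \<in> {A, B}" "D \<in> {A, B}" "C \<noteq> D" for C D
  proof -
    have "closedin (top_of_set (- ?F)) D"
      using that(2) AB(2) closedin_component[of D "- ?F"] by simp
    then have "openin (top_of_set (- ?F)) (- ?F - D)"
      by (metis openin_diff openin_subtopology_self)
    moreover have "- ?F - D = C" using that cov disj by blast
    ultimately show ?thesis using \<open>open (- ?F)\<close> by (simp add: openin_open_eq)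
  qed
  have "r ` B = A" unfolding AB(3)[symmetric] image_comp inv by simp
  moreover have "separates r A B"
    unfolding separates_def using op[of A B] op[of B A] AB(1) by (intro conjI iso disj cov) blast+
  \<comment> \<open>Without fixed points the complement would be the whole space, which is connected
    and has only one component.\<close>
  moreover have "\<exists>p. r p = p"
  proof (rule ccontr)
    assume "\<not> ?thesis"
    then have "- ?F = UNIV" by blast
    moreover have "connected (UNIV :: 'a set)"
      by (intro geo_convex_connected) (simp add: geo_convex_def)
    ultimately have "components (- ?F) = {UNIV}"
      by (simp add: components_eq_sing_iff)
    then show False using AB(1,2) by (metis doubleton_eq_iff insert_absorb2)
  qed
  ultimately show thesis using that AB(3) by blast
qed

end

section \<open>Conjugates, minimal sets and axes\<close>

lemma transl_len_le: "transl_len g \<le> dist x (g x)"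
  unfolding transl_len_def by (intro cInf_lower bdd_belowI[of _ 0]) auto

lemma Min_set_inv_funpow:
  assumes "isometry g" "x \<in> Min_set g"
  shows "inv (g ^^ n) x \<in> Min_set g"
proof -
  let ?h = "g ^^ n"
  have h: "isometry ?h" by (rule isometry_funpow[OF assms(1)])
  have "dist (inv ?h x) (g (inv ?h x)) = dist (?h (inv ?h x)) (?h (g (inv ?h x)))"
    by (simp add: isometry_dist[OF h])
  also have "?h (g (inv ?h x)) = g (?h (inv ?h x))" by (simp add: funpow_swap1)
  finally show ?thesis using assms(2) by (simp add: Min_set_def isometry_f_inv[OF h])
qed

text \<open>A ray fixed by the conjugate is the image under \<open>\<gamma> ^^ n\<close> of a ray
  fixed by \<open>r\<close>; the invariance under \<open>\<gamma>\<close> is then applied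
  \<open>n\<close> times.\<close>

lemma bdry_of_conjugate_fixpoints_subset:
  fixes \<gamma> r :: "'a::metric_space \<Rightarrow> 'a"
  assumes \<gamma>: "isometry \<gamma>"
    and inv: "\<forall>\<xi>\<in>bdry_of {x. r x = x}. bdry_act \<gamma> \<xi> \<in> bdry_of {x. r x = x}"
  shows "bdry_of {x. (\<gamma> ^^ n \<circ> r \<circ> inv (\<gamma> ^^ n)) x = x} \<subseteq> bdry_of {x. r x = x}"
proof
  have *: "ray_class (\<gamma> ^^ k \<circ> d) \<in> bdry_of {x. r x = x}"
    if d: "geodesic_ray d" "d ` {0..} \<subseteq> {x. r x = x}" for d k
  proof (induction k)
    case 0
    then show ?case
      using d ray_class_self[OF d(1)] ray_class_in_vis_bdry[OF d(1)] unfolding bdry_of_def by auto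
  next
    case (Suc k)
    let ?d = "\<gamma> ^^ k \<circ> d"
    have ray: "geodesic_ray ?d" by (intro geodesic_ray_isometry isometry_funpow \<gamma> d)
    \<comment> \<open>\<open>bdry_act\<close> uses a chosen representative; it is asymptotic to
      \<open>?d\<close>, so the image class is the same.\<close>
    have "(SOME c. c \<in> ray_class ?d) \<in> ray_class ?d" using ray_class_self[OF ray] by (rule someI[where P = "\<lambda>c. c \<in> ray_class ?d"])
    then have "asymptotic ?d (SOME c. c \<in> ray_class ?d)" by (simp add: ray_class_def)
    then have "bdry_act \<gamma> (ray_class ?d) = ray_class (\<gamma> \<circ> ?d)"
      unfolding bdry_act_def by (intro ray_class_eq[symmetric] asymptotic_isometry \<gamma>)
    moreover have "\<gamma> \<circ> ?d = \<gamma> ^^ Suc k \<circ> d" by (simp add: comp_assoc)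
    ultimately show ?case using inv Suc by metis
  qed
  let ?g = "\<gamma> ^^ n"
  have g: "isometry ?g" by (rule isometry_funpow[OF \<gamma>])
  fix \<xi> assume "\<xi> \<in> bdry_of {x. (?g \<circ> r \<circ> inv ?g) x = x}"
  then obtain c where vis: "\<xi> \<in> vis_bdry" and c: "c \<in> \<xi>" "c ` {0..} \<subseteq> {x. (?g \<circ> r \<circ> inv ?g) x = x}"
    unfolding bdry_of_def by blast
  have ray: "geodesic_ray c" "\<xi> = ray_class c" using vis_bdry_member[OF vis c(1)] by auto
  have "r (inv ?g (c t)) = inv ?g (c t)" if "0 \<le> t" for t
  proof -
    have "?g (r (inv ?g (c t))) = c t" using c(2) that by auto
    then show ?thesis using isometry_inv_f[OF g] by metis
  qed
  then have "(inv ?g \<circ> c) ` {0..} \<subseteq> {x. r x = x}" by auto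
  then have "ray_class (?g \<circ> (inv ?g \<circ> c)) \<in> bdry_of {x. r x = x}"
    by (intro * geodesic_ray_isometry isometry_inv g ray)
  moreover have "?g \<circ> (inv ?g \<circ> c) = c" by (simp add: fun_eq_iff isometry_f_inv[OF g])
  ultimately show "\<xi> \<in> bdry_of {x. r x = x}" using ray(2) by simp
qed

text \<open>Between points of different pieces, the path through \<open>q\<close> bounds the
  distance from above. A smaller distance would give a path from \<open>p\<close> to
  \<open>r\<close> shorter than \<open>dist p r\<close>.\<close>

lemma geodesic_seg_concat:
  assumes \<sigma>: "geodesic_seg \<sigma> p q" and \<tau>: "geodesic_seg \<tau> q r"
    and add: "dist p r = dist p q + dist q r"
  shows "geodesic_seg (\<lambda>t. if t \<le> dist p q then \<sigma> t else \<tau> (t - dist p q)) p r"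
proof -
  let ?\<kappa> = "\<lambda>t. if t \<le> dist p q then \<sigma> t else \<tau> (t - dist p q)"
  have \<sigma>': "\<sigma> 0 = p" "\<sigma> (dist p q) = q"
      "\<And>s t. 0 \<le> s \<Longrightarrow> s \<le> dist p q \<Longrightarrow> 0 \<le> t \<Longrightarrow> t \<le> dist p q \<Longrightarrow> dist (\<sigma> s) (\<sigma> t) = \<bar>s - t\<bar>"
    and \<tau>': "\<tau> 0 = q" "\<tau> (dist q r) = r"
      "\<And>s t. 0 \<le> s \<Longrightarrow> s \<le> dist q r \<Longrightarrow> 0 \<le> t \<Longrightarrow> t \<le> dist q r \<Longrightarrow> dist (\<tau> s) (\<tau> t) = \<bar>s - t\<bar>"
    using \<sigma> \<tau> unfolding geodesic_seg_def by auto
  have mixed: "dist (\<sigma> s) (\<tau> (t - dist p q)) = t - s"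
    if "0 \<le> s" "s \<le> dist p q" "dist p q < t" "t \<le> dist p r" for s t
  proof -
    have "dist p (\<sigma> s) = s" "dist (\<sigma> s) q = dist p q - s"
      using \<sigma>'(3)[of 0 s] \<sigma>'(3)[of s "dist p q"] \<sigma>' that by auto
    moreover have "dist q (\<tau> (t - dist p q)) = t - dist p q" "dist (\<tau> (t - dist p q)) r = dist p r - t"
      using \<tau>'(3)[of 0 "t - dist p q"] \<tau>'(3)[of "t - dist p q" "dist q r"] \<tau>' that add by auto
    ultimately show ?thesis
      using dist_triangle[of "\<sigma> s" "\<tau> (t - dist p q)" q] dist_triangle[of p r "\<sigma> s"]
        dist_triangle[of "\<sigma> s" r "\<tau> (t - dist p q)"] by linarith
  qed
  have "dist (?\<kappa> s) (?\<kappa> t) = \<bar>s - t\<bar>" if "0 \<le> s" "s \<le> dist p r" "0 \<le> t" "t \<le> dist p r" for s t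
  proof (cases "s \<le> dist p q"; cases "t \<le> dist p q")
    assume "\<not> s \<le> dist p q" "t \<le> dist p q"
    then show ?thesis using mixed[of t s] that by (simp add: dist_commute)
  qed (use that mixed[of s t] \<sigma>'(3)[of s t] \<tau>'(3)[of "s - dist p q" "t - dist p q"] add in auto)
  moreover have "?\<kappa> (dist p r) = r"
    using add \<sigma>'(2) \<tau>' by (cases "dist q r = 0") auto
  ultimately show ?thesis using \<sigma>'(1) unfolding geodesic_seg_def by auto
qed

context proper_CAT0
begin

lemma Min_set_geo_convex:
  assumes "isometry (g :: 'a \<Rightarrow> 'a)"
  shows "geo_convex (Min_set g)"
  unfolding geo_convex_def
proof (intro ballI allI impI subsetI)
  fix x y z c
  assume xy: "x \<in> Min_set g" "y \<in> Min_set g" and c: "geodesic_seg c x y" and "z \<in> c ` {0..dist x y}"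
  then obtain t where t: "z = c t" "0 \<le> t" "t \<le> dist x y" by auto
  show "z \<in> Min_set g"
  proof (cases "x = y")
    case True
    then show ?thesis using t c xy by (simp add: geodesic_seg_def)
  next
    case False
    define s where "s = t / dist x y"
    have s: "0 \<le> s" "s \<le> 1" "s * dist x y = t" using t False by (auto simp: s_def)
    have "dist z (g z) \<le> (1 - s) * transl_len g + s * transl_len g"
      using displacement_convex_segment[OF assms c s(1,2)] xy s(3) t(1) by (simp add: Min_set_def)
    then have "dist z (g z) \<le> transl_len g" by (simp add: algebra_simps)
    then show ?thesis using transl_len_le[of g z] by (simp add: Min_set_def)
  qed
qed

text \<open>If \<open>m\<close> is the midpoint of \<open>[x, g x]\<close>, then \<open>m\<close> and \<open>g m\<close> are the midpoints of two sides of the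
  triangle \<open>x, g x, g (g x)\<close>.\<close>

lemma displacement_double:
  fixes g :: "'a \<Rightarrow> 'a"
  assumes g: "isometry g" and L: "\<And>x. L \<le> dist x (g x)"
  shows "2 * L \<le> dist x (g (g x))"
proof -
  obtain \<sigma> where \<sigma>: "geodesic_seg \<sigma> x (g x)" using geodesic_exists by blast
  let ?m = "\<sigma> (dist x (g x) / 2)"
  have "dist (\<sigma> (dist x (g x) - 1/2 * dist (g x) x)) ((g \<circ> \<sigma>) (1/2 * dist (g x) (g (g x))))
      \<le> 1/2 * dist x (g (g x))"
    by (rule CAT0_dist_scaled[OF CAT0 geodesic_seg_reverse[OF \<sigma>] geodesic_seg_isometry[OF g \<sigma>]]) auto
  then have "dist ?m (g ?m) \<le> 1/2 * dist x (g (g x))"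
    by (simp add: isometry_dist[OF g] dist_commute[of "g x" x])
  then show ?thesis using L[of ?m] by simp
qed

text \<open>\<open>displacement_double\<close> applies to the isometry \<open>g ^^ (2 ^ k)\<close>,
  whose displacement is bounded below at every point by the induction hypothesis.\<close>

lemma displacement_power_two:
  fixes g :: "'a \<Rightarrow> 'a"
  assumes g: "isometry g" and L: "\<And>x. L \<le> dist x (g x)"
  shows "2 ^ k * L \<le> dist x ((g ^^ (2 ^ k)) x)"
proof (induction k arbitrary: x)
  case 0
  then show ?case using L by simp
next
  case (Suc k)
  have "g ^^ (2 ^ Suc k) = g ^^ (2 ^ k) \<circ> g ^^ (2 ^ k)"
    by (metis funpow_add mult_2 power_Suc)
  then show ?case using displacement_double[OF isometry_funpow[OF g] Suc, of x] by simp
qed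

text \<open>The triangle inequality gives the upper bound. The lower bound is known for powers of
  two; an arbitrary \<open>n\<close> is completed to \<open>2 ^ k = n + j\<close>, and the last
  \<open>j\<close> steps cover at most \<open>real j * ?L\<close>.\<close>

lemma Min_set_orbit_dist:
  fixes g :: "'a \<Rightarrow> 'a"
  assumes g: "isometry g" and y: "y \<in> Min_set g"
  shows "dist ((g ^^ m) y) ((g ^^ (m + n)) y) = real n * transl_len g"
proof -
  let ?L = "transl_len g"
  have shift: "dist ((g ^^ m) y) ((g ^^ (m + n)) y) = dist y ((g ^^ n) y)" for m n
    by (simp add: funpow_add isometry_dist[OF isometry_funpow[OF g]])
  have upper: "dist y ((g ^^ n) y) \<le> real n * ?L" for n
  proof (induction n)
    case (Suc n)
    have "dist ((g ^^ n) y) ((g ^^ Suc n) y) = ?L"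
      using shift[of n 1] y by (simp add: Min_set_def)
    then show ?case using dist_triangle[of y "(g ^^ Suc n) y" "(g ^^ n) y"] Suc
      by (simp add: algebra_simps)
  qed simp
  obtain k :: nat where "n < 2 ^ k" using less_exp by blast
  then obtain j where j: "2 ^ k = n + j" using less_imp_add_positive by metis
  have "2 ^ k * ?L \<le> dist y ((g ^^ (n + j)) y)"
    using displacement_power_two[OF g transl_len_le, where k = k and x = y] j by simp
  also have "\<dots> \<le> dist y ((g ^^ n) y) + dist ((g ^^ n) y) ((g ^^ (n + j)) y)" by (rule dist_triangle)
  also have "dist ((g ^^ n) y) ((g ^^ (n + j)) y) \<le> real j * ?L" using upper by (simp only: shift)
  finally have "2 ^ k * ?L \<le> dist y ((g ^^ n) y) + real j * ?L" by simp
  moreover have "(2 ^ k :: real) = real n + real j"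
    using j by (metis of_nat_add of_nat_numeral of_nat_power)
  ultimately have "real n * ?L \<le> dist y ((g ^^ n) y)" by (simp add: algebra_simps)
  then show ?thesis using upper[of n] shift by simp
qed

text \<open>Orbit distances add up, so by concatenation and uniqueness of geodesics each segment
  from \<open>y\<close> to an orbit point begins with the shorter ones. The segments glue to a ray,
  which stays in the convex set \<open>Min_set g\<close>.\<close>

lemma axis_ray_exists:
  fixes g :: "'a \<Rightarrow> 'a"
  assumes "hyperbolic g" and y: "y \<in> Min_set g"
  obtains c where "geodesic_ray c" "c 0 = y" "\<And>n. c (real n * transl_len g) = (g ^^ n) y"
    "\<And>t. 0 \<le> t \<Longrightarrow> c t \<in> Min_set g"
proof -
  define L where "L = transl_len g"
  have g: "isometry g" and L: "0 < L" using assms(1) by (auto simp: hyperbolic_def L_def)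
  obtain \<sigma> where \<sigma>: "\<And>n. geodesic_seg (\<sigma> n) y ((g ^^ n) y)"
    using choice[of "\<lambda>n s. geodesic_seg s y ((g ^^ n) y)"] geodesic_exists by blast
  have len: "dist y ((g ^^ n) y) = real n * L" for n
    using Min_set_orbit_dist[OF g y, of 0 n] by (simp add: L_def)
  have consistent: "\<sigma> m t = \<sigma> n t" if "m \<le> n" "0 \<le> t" "t \<le> real m * L" for m n t
  proof -
    obtain j where n: "n = m + j" using \<open>m \<le> n\<close> le_Suc_ex by blast
    obtain \<tau> where \<tau>: "geodesic_seg \<tau> ((g ^^ m) y) ((g ^^ n) y)" using geodesic_exists by blast
    have d: "dist ((g ^^ m) y) ((g ^^ n) y) = real j * L"
      using Min_set_orbit_dist[OF g y, of m j] n by (simp add: L_def)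
    have "dist y ((g ^^ n) y) = dist y ((g ^^ m) y) + dist ((g ^^ m) y) ((g ^^ n) y)"
      unfolding d len by (simp add: n algebra_simps)
    moreover have "t \<le> dist y ((g ^^ n) y)"
      using that L len[of n] mult_right_mono[of "real m" "real n" L] by linarith
    ultimately show ?thesis
      using geodesic_unique[OF \<sigma>[of n] geodesic_seg_concat[OF \<sigma>[of m] \<tau>], of t] that len by simp
  qed
  \<comment> \<open>The index is the least \<open>n\<close> for which the segment to
    \<open>(g ^^ n) y\<close> reaches parameter \<open>t\<close>.\<close>
  define c where "c t = \<sigma> (nat \<lceil>t / L\<rceil>) t" for t
  have ceil: "t \<le> real (nat \<lceil>t / L\<rceil>) * L" for t
    using L by (simp add: pos_divide_le_eq[symmetric] real_nat_ceiling_ge)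
  have c\<sigma>: "c t = \<sigma> n t" if "0 \<le> t" "t \<le> real n * L" for n t
  proof -
    have "nat \<lceil>t / L\<rceil> \<le> n" using that L by (simp add: nat_le_iff ceiling_le_iff pos_divide_le_eq)
    then show ?thesis unfolding c_def using consistent ceil that(1) by blast
  qed
  have "geodesic_ray c"
    unfolding geodesic_ray_def
  proof (intro allI impI)
    fix s t :: real assume st: "0 \<le> s" "0 \<le> t"
    define n where "n = nat \<lceil>max s t / L\<rceil>"
    have n: "s \<le> real n * L" "t \<le> real n * L" using ceil[of "max s t"] unfolding n_def by auto
    then show "dist (c s) (c t) = \<bar>s - t\<bar>"
      using \<sigma>[of n] st c\<sigma>[of s n] c\<sigma>[of t n] len[of n] unfolding geodesic_seg_def by auto
  qed
  moreover have "c (real n * transl_len g) = (g ^^ n) y" for n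
    using c\<sigma>[of "real n * L" n] \<sigma>[of n] L len[of n] unfolding geodesic_seg_def L_def by auto
  moreover from this[of 0] have "c 0 = y" by simp
  moreover have "c t \<in> Min_set g" if "0 \<le> t" for t
  proof -
    define n where "n = nat \<lceil>t / L\<rceil>"
    have "(g ^^ n) y \<in> Min_set g"
      using Min_set_orbit_dist[OF g y, of n 1] by (simp add: Min_set_def)
    then have "\<sigma> n ` {0..real n * L} \<subseteq> Min_set g"
      using Min_set_geo_convex[OF g] y \<sigma>[of n] len[of n] unfolding geo_convex_def by metis
    then show ?thesis using that ceil[of t] unfolding c_def n_def by auto
  qed
  ultimately show thesis using that by blast
qed

section \<open>Convergence in the cone topology\<close>

lemma segments_converge_to_ray:
  fixes c :: "real \<Rightarrow> 'a"
  assumes c: "geodesic_ray c" and L: "0 < L" and K: "\<And>n. dist (c (real n * L)) (z n) \<le> K"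
    and t: "0 < t" and e: "0 < e"
  shows "eventually (\<lambda>n. t < dist (c 0) (z n) \<and>
           (\<forall>\<sigma>. geodesic_seg \<sigma> (c 0) (z n) \<longrightarrow> dist (\<sigma> t) (c t) < e)) sequentially"
proof -
  have "0 \<le> K" using K[of 0] zero_le_dist order_trans by blast
  \<comment> \<open>The first bound makes the segments longer than \<open>t\<close>; the second
    brings the error \<open>2 * t * K / (real n * L)\<close> below \<open>e\<close>.\<close>
  obtain N where N: "max (t + K) (2 * t * K / e) < real N * L"
    using reals_Archimedean3[OF L] by blast
  have "t < dist (c 0) (z n) \<and> (\<forall>\<sigma>. geodesic_seg \<sigma> (c 0) (z n) \<longrightarrow> dist (\<sigma> t) (c t) < e)"
    if "N \<le> n" for n
  proof -
    let ?l = "real n * L"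
    have "real N * L \<le> ?l" using that L by simp
    then have l: "t + K < ?l" "2 * t * K / e < ?l" using N by auto
    then have "0 < ?l" using t \<open>0 \<le> K\<close> by linarith
    have dl: "dist (c 0) (c ?l) = ?l" using c \<open>0 < ?l\<close> unfolding geodesic_ray_def by auto
    have far: "t < dist (c 0) (z n)"
      using dist_triangle[of "c 0" "c ?l" "z n"] K[of n] l(1) dl by (simp add: dist_commute)
    have "dist (\<sigma> t) (c t) < e" if \<sigma>: "geodesic_seg \<sigma> (c 0) (z n)" for \<sigma>
    proof -
      have "dist (c t) (\<sigma> t) \<le> 2 * t * dist (c ?l) (z n) / ?l"
        using geodesics_dist_at_time[OF geodesic_ray_initial_segment[OF c, of ?l] \<sigma>, of t]
          far l t \<open>0 \<le> K\<close> \<open>0 < ?l\<close> dl by simp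
      also have "\<dots> \<le> 2 * t * K / ?l"
        using K[of n] t \<open>0 < ?l\<close> by (intro divide_right_mono mult_left_mono) auto
      also have "\<dots> < e"
        using l(2) e \<open>0 < ?l\<close> by (simp only: pos_divide_less_eq mult.commute)
      finally show ?thesis by (simp add: dist_commute)
    qed
    then show ?thesis using far by blast
  qed
  then show ?thesis unfolding eventually_sequentially by blast
qed

text \<open>Induction over the generated topology reduces the claim to subbasic sets. Their centre
  \<open>d\<close> need not be \<open>c\<close>, so the slack \<open>e - dist (c t) (d t)\<close>
  serves as the tolerance.\<close>

lemma eventually_in_cone_open:
  fixes c :: "real \<Rightarrow> 'a"
  assumes c: "geodesic_ray c" "c 0 = x0" and \<zeta>: "\<And>n. geodesic_ray (\<zeta> n)" "\<And>n. \<zeta> n 0 = x0"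
    and conv: "\<And>t e. 0 < t \<Longrightarrow> 0 < e \<Longrightarrow> eventually (\<lambda>n. dist (\<zeta> n t) (c t) < e) sequentially"
    and W: "openin (cone_topology x0) W" "ray_class c \<in> W"
  shows "eventually (\<lambda>n. ray_class (\<zeta> n) \<in> W) sequentially"
proof -
  have "generate_topology_on {cone_nbhd x0 c t e | c t e. geodesic_ray c \<and> c 0 = x0 \<and> t > 0 \<and> e > 0} W"
    using W(1) unfolding cone_topology_def openin_topology_generated_by_iff .
  then show ?thesis using W(2)
  proof (induction rule: generate_topology_on.induct)
    case Empty
    then show ?case by simp
  next
    case (Int a b)
    then show ?case by (auto intro: eventually_conj)
  next
    case (UN K)
    then obtain k where "k \<in> K" "ray_class c \<in> k" by blast
    then have "eventually (\<lambda>n. ray_class (\<zeta> n) \<in> k) sequentially" using UN.IH by blast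
    then show ?case by (rule eventually_mono) (use \<open>k \<in> K\<close> in blast)
  next
    case (Basis s)
    then obtain d t e where s: "s = cone_nbhd x0 d t e" and d: "t > 0" by blast
    obtain c' where c': "c' \<in> ray_class c" "c' 0 = x0" "dist (c' t) (d t) < e"
      using Basis.prems unfolding s cone_nbhd_def by blast
    have "c t = c' t"
      using c' c d asymptotic_rays_eq[OF c(1), of c' t] by (simp add: ray_class_def)
    then have "0 < e - dist (c t) (d t)" using c'(3) by simp
    then have "eventually (\<lambda>n. dist (\<zeta> n t) (c t) < e - dist (c t) (d t)) sequentially"
      by (rule conv[OF d])
    then show ?case
    proof (rule eventually_mono)
      fix n assume "dist (\<zeta> n t) (c t) < e - dist (c t) (d t)"
      then have "dist (\<zeta> n t) (d t) < e" using dist_triangle[of "\<zeta> n t" "d t" "c t"] by simp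
      then show "ray_class (\<zeta> n) \<in> s"
        unfolding s cone_nbhd_def
        using \<zeta> ray_class_self[OF \<zeta>(1)] ray_class_in_vis_bdry[OF \<zeta>(1)] by blast
    qed
  qed
qed

end

section \<open>Splitting neighbourhoods of the attracting end point\<close>

theorem theorem1p1:
  fixes \<gamma> r :: "'a::metric_space \<Rightarrow> 'a" and x0 :: 'a
  assumes "proper_space TYPE('a)" and "CAT0 TYPE('a)" and "almost_extendible TYPE('a)"
    and "hyperbolic \<gamma>" and "reflection r"
    and "\<forall>\<xi>. conv_to_bdry x0 (\<lambda>i. (\<gamma> ^^ i) x0) \<xi> \<longrightarrow> \<xi> \<notin> bdry_of {x. r x = x}"
    and "\<forall>\<xi>\<in>bdry_of {x. r x = x}. bdry_act \<gamma> \<xi> \<in> bdry_of {x. r x = x}"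
    and "Min_set \<gamma> \<inter> {x. r x = x} = {}"
  shows "\<not> locally_connected_space (cone_topology x0)"
proof
  assume lc: "locally_connected_space (cone_topology x0)"
  interpret proper_CAT0 "TYPE('a)" using assms(1,2) by unfold_locales
  let ?F = "{x. r x = x}"
  define L where "L = transl_len \<gamma>"
  have \<gamma>: "isometry \<gamma>" and L: "0 < L" using assms(4) by (auto simp: hyperbolic_def L_def)
  have iso: "isometry (\<gamma> ^^ n)" for n by (rule isometry_funpow[OF \<gamma>])
  obtain y where y: "y \<in> Min_set \<gamma>" using assms(4) by (auto simp: hyperbolic_def)
  \<comment> \<open>The convex set \<open>Min_set \<gamma>\<close> misses the fixed-point set, so it
    lies on one side, which is named \<open>A\<close>; exchanging the sides is harmless since
    \<open>r\<close> swaps them.\<close>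
  have "\<exists>A B p. separates r A B \<and> r ` A = B \<and> r p = p \<and> Min_set \<gamma> \<subseteq> A"
  proof -
    obtain A B p where AB: "separates r A B" "r ` A = B" "r ` B = A" "r p = p"
      using reflection_separates[OF assms(5)] by metis
    have sub: "Min_set \<gamma> \<subseteq> C" if "separates r C D" "y \<in> C" for C D
      using connected_subset_side[OF that(1) geo_convex_connected[OF Min_set_geo_convex[OF \<gamma>]] y that(2)]
        assms(8) by blast
    have "y \<in> A \<or> y \<in> B" using AB(1) y assms(8) unfolding separates_def by blast
    then show ?thesis using sub[of A B] sub[of B A] AB separates_commute by blast
  qed
  then obtain A B p where sep: "separates r A B" and rA: "r ` A = B" and p: "r p = p"
    and MinA: "Min_set \<gamma> \<subseteq> A" by blast
  have r: "isometry r" using sep by (simp add: separates_def)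
  obtain c where c: "geodesic_ray c" "c 0 = y" "\<And>n. c (real n * L) = (\<gamma> ^^ n) y"
      "\<And>t. 0 \<le> t \<Longrightarrow> c t \<in> Min_set \<gamma>"
    using axis_ray_exists[OF assms(4) y] unfolding L_def by metis
  define \<omega> where "\<omega> = ray_class c"
  obtain c0 where c0: "geodesic_ray c0" "c0 0 = x0" "asymptotic c c0"
    using asymptotic_ray_exists[OF c(1)] by blast
  have \<omega>: "\<omega> = ray_class c0" unfolding \<omega>_def by (rule ray_class_eq[OF c0(3)])
  have \<omega>_vis: "\<omega> \<in> vis_bdry" unfolding \<omega>_def by (rule ray_class_in_vis_bdry[OF c(1)])
  have near_axis: "dist (c0 (real n * L)) ((\<gamma> ^^ n) y) \<le> dist x0 y" for n
    using asymptotic_rays_dist_antimono[OF c(1) c0(1,3), of 0 "real n * L"] L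
    by (simp add: c c0 dist_commute)
  \<comment> \<open>The orbit of \<open>x0\<close> stays within \<open>2 * dist x0 y\<close> of the
    points \<open>c0 (real n * L)\<close>, so it converges to \<open>\<omega>\<close>, and the
    hypothesis on \<gamma> at infinity applies to \<open>\<omega>\<close>.\<close>
  have "conv_to_bdry x0 (\<lambda>i. (\<gamma> ^^ i) x0) \<omega>"
    unfolding conv_to_bdry_def
  proof (intro conjI ballI impI allI \<omega>_vis)
    fix d t e assume d: "d \<in> \<omega>" "d 0 = x0" and t: "0 < (t::real)" and e: "0 < (e::real)"
    have "d t = c0 t"
      using d t c0 asymptotic_rays_eq[OF c0(1), of d t] unfolding \<omega> ray_class_def by simp
    have "dist (c0 (real n * L)) ((\<gamma> ^^ n) x0) \<le> 2 * dist x0 y" for n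
      using near_axis[of n] dist_triangle[of "c0 (real n * L)" "(\<gamma> ^^ n) x0" "(\<gamma> ^^ n) y"]
      by (simp add: isometry_dist[OF iso] dist_commute)
    from segments_converge_to_ray[OF c0(1) L this t e]
    show "eventually (\<lambda>i. t < dist x0 ((\<gamma> ^^ i) x0) \<and>
        (\<exists>\<sigma>. geodesic_seg \<sigma> x0 ((\<gamma> ^^ i) x0) \<and> dist (\<sigma> t) (d t) < e)) sequentially"
      unfolding c0(2) \<open>d t = c0 t\<close> by (rule eventually_mono) (use geodesic_exists in blast)
  qed
  then have \<omega>_nin: "\<omega> \<notin> bdry_of ?F" using assms(6) by blast

  define R where "R n = \<gamma> ^^ n \<circ> r \<circ> inv (\<gamma> ^^ n)" for n
  have sepR: "separates (R n) ((\<gamma> ^^ n) ` A) ((\<gamma> ^^ n) ` B)" for n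
    unfolding R_def by (rule separates_conjugate[OF sep iso])
  have fixR: "R n ((\<gamma> ^^ n) p) = (\<gamma> ^^ n) p" for n
    by (simp add: R_def isometry_inv_f[OF iso] p)
  have bdryR: "bdry_of {x. R n x = x} \<subseteq> bdry_of ?F" for n
    unfolding R_def by (rule bdry_of_conjugate_fixpoints_subset[OF \<gamma> assms(7)])
  have MinR: "Min_set \<gamma> \<subseteq> (\<gamma> ^^ n) ` A" for n
  proof
    fix x assume "x \<in> Min_set \<gamma>"
    then have "inv (\<gamma> ^^ n) x \<in> A" using Min_set_inv_funpow[OF \<gamma>] MinA by blast
    then show "x \<in> (\<gamma> ^^ n) ` A" using isometry_f_inv[OF iso, of n x] by (metis imageI)
  qed
  have \<omega>_side: "\<omega> \<in> bdry_side (R n) ((\<gamma> ^^ n) ` A)" for n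
  proof -
    have "\<exists>t\<ge>0. K < dist (c t) (R n (c t))" for K
    proof (rule displacement_unbounded[where r = "R n", OF _ fixR c(1)])
      show "isometry (R n)" using sepR by (simp add: separates_def)
      show "ray_class c \<notin> bdry_of {x. R n x = x}" using \<omega>_nin bdryR unfolding \<omega>_def by blast
    qed
    moreover have "\<forall>t\<ge>0. c t \<in> (\<gamma> ^^ n) ` A" using c(4) MinR by blast
    ultimately show ?thesis
      using \<omega>_vis ray_class_self[OF c(1)] unfolding bdry_side_def \<omega>_def by blast
  qed

  obtain M where M: "M > 0" "\<And>x y::'a. \<exists>\<zeta>. geodesic_ray \<zeta> \<and> \<zeta> 0 = x \<and> (\<exists>t\<ge>0. dist (\<zeta> t) y \<le> M)"
    using assms(3) unfolding almost_extendible_def by blast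
  \<comment> \<open>Displacement above \<open>2 * M\<close> makes a point so deep that everything
    within \<open>M\<close> of it is on its side. The mirror image \<open>x\<close> of such an axis
    point is equally deep and lies in \<open>B\<close>.\<close>
  obtain s where s: "s \<ge> 0" "2 * M < dist (c s) (r (c s))"
    using displacement_unbounded[OF r p c(1)] \<omega>_nin unfolding \<omega>_def by blast
  define x where "x = r (c s)"
  have xB: "x \<in> B" using rA c(4)[OF s(1)] MinA unfolding x_def by blast
  have x_deep: "2 * M < dist x (r x)" using s(2) by (simp add: x_def isometry_dist[OF r])
  have "\<exists>\<zeta> T. geodesic_ray \<zeta> \<and> \<zeta> 0 = y \<and> 0 \<le> T \<and> dist (\<zeta> T) ((\<gamma> ^^ n) x) \<le> M" for n
    using M(2)[of y "(\<gamma> ^^ n) x"] by blast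
  then obtain \<zeta> T where \<zeta>: "\<And>n. geodesic_ray (\<zeta> n)" "\<And>n. \<zeta> n 0 = y" "\<And>n. 0 \<le> T n"
      "\<And>n. dist (\<zeta> n (T n)) ((\<gamma> ^^ n) x) \<le> M"
    by metis
  \<comment> \<open>The ray starts on the axis side and passes within \<open>M\<close> of the deep
    point \<open>(\<gamma> ^^ n) x\<close>, so it meets the fixed-point set of \<open>R n\<close> at
    some time \<open>a\<close>. From there displacement rises from 0 to a positive value at
    \<open>T n\<close>, and \<open>bdry_sideI\<close> applies.\<close>
  have \<zeta>_side: "ray_class (\<zeta> n) \<in> bdry_side (R n) ((\<gamma> ^^ n) ` B)" for n
  proof -
    let ?x = "(\<gamma> ^^ n) x"
    have "dist ?x (R n ?x) = dist x (r x)"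
      by (simp add: R_def isometry_inv_f[OF iso] isometry_dist[OF iso])
    then have end_B: "\<zeta> n (T n) \<in> (\<gamma> ^^ n) ` B"
      using near_deep_point_same_side[OF separates_commute[OF sepR], of ?x n "\<zeta> n (T n)" M]
        \<zeta>(4)[of n] xB x_deep by (simp add: dist_commute)
    have disj: "(\<gamma> ^^ n) ` A \<inter> (\<gamma> ^^ n) ` B = {}" and cov: "(\<gamma> ^^ n) ` A \<union> (\<gamma> ^^ n) ` B = - {x. R n x = x}"
      using sepR[of n] unfolding separates_def by blast+
    have "connected (\<zeta> n ` {0..T n})"
      by (intro connected_continuous_image continuous_on_subset[OF geodesic_ray_continuous_on[OF \<zeta>(1)]]) auto
    moreover have "\<zeta> n 0 \<in> (\<gamma> ^^ n) ` A" using MinR y \<zeta>(2) by auto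
    moreover have "\<zeta> n 0 \<in> \<zeta> n ` {0..T n}" "\<zeta> n (T n) \<in> \<zeta> n ` {0..T n}"
      using \<zeta>(3)[of n] by (auto intro: imageI)
    moreover have "\<zeta> n (T n) \<notin> (\<gamma> ^^ n) ` A" using end_B disj by blast
    ultimately have "\<exists>z \<in> \<zeta> n ` {0..T n}. R n z = z"
      using connected_subset_side[OF sepR[of n], of "\<zeta> n ` {0..T n}" "\<zeta> n 0"] by blast
    then obtain a where a: "0 \<le> a" "a \<le> T n" "R n (\<zeta> n a) = \<zeta> n a" by auto
    have "R n (\<zeta> n (T n)) \<noteq> \<zeta> n (T n)" using end_B cov by blast
    then have "a < T n" using a by (metis order_le_less)
    moreover have "dist (\<zeta> n a) (R n (\<zeta> n a)) < dist (\<zeta> n (T n)) (R n (\<zeta> n (T n)))"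
      using a(3) \<open>R n (\<zeta> n (T n)) \<noteq> \<zeta> n (T n)\<close> by simp
    ultimately show ?thesis
      by (intro bdry_sideI[OF separates_commute[OF sepR] \<zeta>(1) a(1) _ _ end_B])
  qed
  obtain \<zeta>' where \<zeta>': "\<And>n. geodesic_ray (\<zeta>' n)" "\<And>n. \<zeta>' n 0 = x0" "\<And>n. asymptotic (\<zeta> n) (\<zeta>' n)"
    using asymptotic_ray_exists[OF \<zeta>(1), where p = x0] by metis
  \<comment> \<open>The four terms bound the steps from \<open>c0 (real n * L)\<close> through
    \<open>(\<gamma> ^^ n) y\<close>, \<open>(\<gamma> ^^ n) x\<close> and
    \<open>\<zeta> n (T n)\<close> to \<open>\<zeta>' n (T n)\<close>. As \<open>K\<close> is
    independent of \<open>n\<close>, the rays \<open>\<zeta>' n\<close> converge to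
    \<open>c0\<close>.\<close>
  define K where "K = dist x0 y + dist y x + M + dist x0 y"
  have K: "dist (c0 (real n * L)) (\<zeta>' n (T n)) \<le> K" for n
  proof -
    have "dist (\<zeta> n (T n)) (\<zeta>' n (T n)) \<le> dist x0 y"
      using asymptotic_rays_dist_antimono[OF \<zeta>(1)[of n] \<zeta>'(1,3)[of n] order_refl \<zeta>(3)[of n]]
      by (simp add: \<zeta>(2) \<zeta>'(2) dist_commute)
    moreover have "dist ((\<gamma> ^^ n) y) ((\<gamma> ^^ n) x) = dist y x" by (rule isometry_dist[OF iso])
    ultimately show ?thesis
      using near_axis[of n] \<zeta>(4)[of n]
        dist_triangle[of "c0 (real n * L)" "\<zeta>' n (T n)" "(\<gamma> ^^ n) y"]
        dist_triangle[of "(\<gamma> ^^ n) y" "\<zeta>' n (T n)" "(\<gamma> ^^ n) x"]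
        dist_triangle[of "(\<gamma> ^^ n) x" "\<zeta>' n (T n)" "\<zeta> n (T n)"]
      unfolding K_def by (simp add: dist_commute)
  qed
  have conv: "eventually (\<lambda>n. dist (\<zeta>' n t) (c0 t) < e) sequentially" if "0 < t" "0 < e" for t e
  proof -
    have "geodesic_seg (\<zeta>' n) (c0 0) (\<zeta>' n (T n))" for n
      using geodesic_ray_initial_segment[OF \<zeta>'(1)[of n] \<zeta>(3)[of n]] by (simp add: \<zeta>'(2) c0(2))
    with segments_converge_to_ray[OF c0(1) L K that] show ?thesis
      by (auto elim: eventually_mono)
  qed

  have "\<omega> \<in> bdry_side r A" using \<omega>_side[of 0] by (simp add: R_def)
  then obtain W where W: "openin (cone_topology x0) W" "connectedin (cone_topology x0) W" "\<omega> \<in> W"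
      "W \<subseteq> bdry_side r A"
    using lc openin_bdry_side[OF sep, of x0] unfolding locally_connected_space by blast
  have "eventually (\<lambda>n. ray_class (\<zeta>' n) \<in> W) sequentially"
    using eventually_in_cone_open[OF c0(1,2) \<zeta>'(1,2) conv W(1)] W(3) \<omega> by simp
  then obtain n where "ray_class (\<zeta>' n) \<in> W"
    using eventually_happens'[OF sequentially_bot] by blast
  then have \<zeta>W: "ray_class (\<zeta> n) \<in> W" using ray_class_eq[OF \<zeta>'(3)] by metis
  \<comment> \<open>\<open>W\<close> misses the boundary of the fixed-point set of \<open>r\<close>,
    hence also that of \<open>R n\<close>. The two disjoint open sides of \<open>R n\<close>
    therefore cover the connected set \<open>W\<close>, yet one contains \<open>\<omega>\<close> and
    the other \<open>ray_class (\<zeta> n)\<close>.\<close>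
  have "W \<subseteq> bdry_side (R n) ((\<gamma> ^^ n) ` A) \<union> bdry_side (R n) ((\<gamma> ^^ n) ` B)"
  proof
    fix \<xi> assume "\<xi> \<in> W"
    then have "\<xi> \<in> bdry_side r A" using W(4) by blast
    then have "\<xi> \<notin> bdry_of {x. R n x = x}"
      using bdry_side_disjoint_bdry_fixpoints[OF _ r] bdryR by blast
    moreover have "\<xi> \<in> vis_bdry" using \<open>\<xi> \<in> bdry_side r A\<close> by (simp add: bdry_side_def)
    ultimately show "\<xi> \<in> bdry_side (R n) ((\<gamma> ^^ n) ` A) \<union> bdry_side (R n) ((\<gamma> ^^ n) ` B)"
      by (intro bdry_sides_cover[OF sepR fixR])
  qed
  moreover have "bdry_side (R n) ((\<gamma> ^^ n) ` A) \<inter> W \<noteq> {}" "bdry_side (R n) ((\<gamma> ^^ n) ` B) \<inter> W \<noteq> {}"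
    using \<omega>_side[of n] \<zeta>_side[of n] \<zeta>W W(3) by blast+
  moreover have "bdry_side (R n) ((\<gamma> ^^ n) ` A) \<inter> bdry_side (R n) ((\<gamma> ^^ n) ` B) = {}"
    by (rule bdry_sides_disjoint[OF sepR])
  moreover have "openin (cone_topology x0) (bdry_side (R n) ((\<gamma> ^^ n) ` A))"
      "openin (cone_topology x0) (bdry_side (R n) ((\<gamma> ^^ n) ` B))"
    using openin_bdry_side[OF sepR] openin_bdry_side[OF separates_commute[OF sepR]] by blast+
  ultimately show False using W(2) unfolding connectedin by blast
qed

end
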